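(* There exist positive real numbers $c_1$ and $c_2$ such that for every integer $X\ge 2$, $$c_1\left(\frac{X}{\log X}\right)^{1/2}\le |S_p(X)|\le c_2\left(\frac{X}{\log X}\right)^{1/2},$$ where $$S_p(X)=\left\{\left\lfloor\frac{X}{p}\right\rfloor : p \text{ prime},\ p\le X\right\}.$$
   Context: $\lfloor x\rfloor$ denotes the greatest integer not exceeding the real number $x$, $\log$ is the natural logarithm, and $|S|$ denotes the number of distinct elements of a finite set $S$. In the notation $S_p(X)$ the subscript $p$ is only a label indicating that the denominators run over primes; $p$ is a bound variable ranging over all primes not exceeding $X$. *)

theory Defs
  imports Complex_Main "HOL-Computational_Algebra.Primes"
begin

definition S_p :: "nat \<Rightarrow> int set" where
  "S_p X = {\<lfloor>real X / real p\<rfloor> | p :: nat. prime p \<and> p \<le> X}"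

end

theory Submission
  imports Defs "HOL-Library.FuncSet" "HOL-Number_Theory.Cong"
    "HOL-Analysis.Harmonic_Numbers" "HOL-Real_Asymp.Real_Asymp"
begin

text \<open>
  Write \<open>L = log X\<close>. The order of magnitude \<open>(X / L)\<^sup>1\<^sup>/\<^sup>2\<close> is found by cutting the primes at
  \<open>Y = (X L)\<^sup>1\<^sup>/\<^sup>2\<close>. The primes up to \<open>Y\<close> number about \<open>2 Y / L\<close>, and the primes above \<open>Y\<close> give
  quotients at most \<open>X / Y\<close>; both quantities are of order \<open>(X / L)\<^sup>1\<^sup>/\<^sup>2\<close>. With Chebyshev's upper bound
  for the number of primes this already proves the upper estimate (\<open>card_S_p_upper\<close>).

  For the lower estimate one shows that a positive proportion of the primes up to \<open>Y\<close> give
  different quotients. If \<open>p < q \<le> Y\<close> have the same quotient, then \<open>X / p - X / q < 1\<close>, so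
  \<open>q - p < Y\<^sup>2 / X = L\<close>. This is the average gap between primes of size \<open>Y\<close>, up to a constant, so
  that the counting function of the primes alone does not decide whether the primes cluster: one has
  to bound the number of close pairs. By the Cauchy-Schwarz inequality
  (\<open>card_squared_le_collisions\<close>), the square of the number \<open>\<pi>(Y)\<close> of primes up to \<open>Y\<close> is at most
  the number of quotients times the number of pairs with equal quotients, and it suffices to show that the latter number is \<open>O(\<pi>(Y))\<close>, or
  equivalently that the number of pairs of primes up to \<open>Y\<close> whose difference is \<open>d\<close>, summed over
  \<open>1 \<le> d \<le> L\<close>, is \<open>O(Y / L)\<close>.

  For one \<open>d\<close> the number of pairs is bounded by the Selberg sieve applied to \<open>n (n + d)\<close>, with two
  forbidden residue classes modulo each odd prime not dividing \<open>d\<close> (\<open>card_prime_pairs_le\<close>). The bound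
  is \<open>O(Y / L\<^sup>2)\<close> times a factor of size \<open>\<Prod>\<^bsub>p | d\<^esub> (1 + O(1 / p))\<close>, and this factor is bounded on average
  over \<open>d\<close> (\<open>sum_prime_factor_products_le\<close>). Chebyshev's lower bound \<open>Y / L = O(\<pi>(Y))\<close> completes the
  argument. Constants are treated generously throughout: a sieve level that is a tiny power of \<open>X\<close>
  is enough, and makes the crudest error estimates sufficient.

  In the sieve, a squarefree number is represented by the set of its prime factors. Divisibility,
  greatest common divisor and least common multiple become inclusion, intersection and union, the
  Moebius function becomes \<open>(-1)\<close> to the cardinality, and sums over divisors of Euler products are
  expanded by \<open>prod_add\<close>.
\<close>

section \<open>Finite sets of primes as squarefree numbers\<close>

definition primes_le :: "nat \<Rightarrow> nat set" where
  "primes_le n = {p. prime p \<and> p \<le> n}"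

lemma finite_primes_le [simp, intro]: "finite (primes_le n)"
  by (rule finite_subset[of _ "{..n}"]) (auto simp: primes_le_def)

lemma prime_primes_le: "p \<in> primes_le n \<Longrightarrow> prime p"
  by (simp add: primes_le_def)

lemma prime_dvd_prod_primes_iff:
  fixes A :: "nat set"
  assumes "finite A" "\<And>q. q \<in> A \<Longrightarrow> prime q" "prime p"
  shows "p dvd \<Prod>A \<longleftrightarrow> p \<in> A"
  using assms primes_dvd_imp_eq by (auto simp: prime_dvd_prod_iff intro: dvd_refl)

lemma prod_primes_dvdI:
  fixes A :: "nat set"
  assumes "finite A" "\<And>p. p \<in> A \<Longrightarrow> prime p" "\<And>p. p \<in> A \<Longrightarrow> p dvd n"
  shows "\<Prod>A dvd n"
  using assms
proof (induction A rule: finite_induct)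
  case (insert p A)
  have "coprime p (\<Prod>A)"
    using insert prime_dvd_prod_primes_iff[of A p] by (intro prime_imp_coprime) auto
  then show ?case
    using insert by (simp add: divides_mult)
qed simp

lemma prod_primes_dvd_iff:
  fixes A :: "nat set"
  assumes "finite A" "\<And>p. p \<in> A \<Longrightarrow> prime p"
  shows "\<Prod>A dvd n \<longleftrightarrow> (\<forall>p\<in>A. p dvd n)"
proof
  assume "\<Prod>A dvd n"
  then show "\<forall>p\<in>A. p dvd n"
    using dvd_prodI[OF assms(1), of _ "\<lambda>p. p"] by (blast intro: dvd_trans)
qed (use assms in \<open>auto intro: prod_primes_dvdI\<close>)

lemma inj_on_prod_primes: "inj_on (\<lambda>A. \<Prod>A) {A :: nat set. finite A \<and> (\<forall>p\<in>A. prime p)}"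
proof (rule inj_onI, clarify)
  fix A B :: "nat set"
  assume *: "finite A" "\<forall>p\<in>A. prime p" "finite B" "\<forall>p\<in>B. prime p" "\<Prod>A = \<Prod>B"
  have "p \<in> A \<longleftrightarrow> p \<in> B" for p
    using *(1-4) prime_dvd_prod_primes_iff[of A p] prime_dvd_prod_primes_iff[of B p] *(5) by metis
  then show "A = B" by blast
qed

section \<open>Chebyshev's bounds for the number of primes\<close>

text \<open>
  Erdos's argument: the primes in \<open>(m + 1, 2 m + 1]\<close> all divide the binomial coefficient
  \<open>2 m + 1\<close> over \<open>m\<close>, which is at most \<open>4 ^ m\<close> as it occurs twice in the row sum \<open>2 ^ (2 m + 1)\<close>.
\<close>

lemma primorial_le: "\<Prod>(primes_le n) \<le> 4 ^ n"
proof (induction n rule: less_induct)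
  case (less n)
  consider "n \<le> 1" | "n = 2" | "n > 2" "even n" | m where "n = 2 * m + 1" "m \<ge> 1"
    by (cases "even n") (force elim!: oddE)+
  then show ?case
  proof cases
    case 1
    then have "primes_le n = {}"
      by (auto simp: primes_le_def dest!: prime_gt_1_nat)
    then show ?thesis by simp
  next
    case 2
    have "primes_le 2 = {2}"
      by (auto simp: primes_le_def) (metis le_antisym prime_ge_2_nat)
    then show ?thesis using 2 by simp
  next
    case 3
    have "\<not> prime n"
      using 3 prime_odd_nat by blast
    then have "primes_le n = primes_le (n - 1)"
      using 3 by (auto simp: primes_le_def order.order_iff_strict)
    then have "\<Prod>(primes_le n) \<le> 4 ^ (n - 1)"
      using less.IH[of "n - 1"] 3 by simp
    also have "\<dots> \<le> 4 ^ n"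
      by (intro power_increasing) auto
    finally show ?thesis .
  next
    case (4 m)
    define B where "B = {p. prime p \<and> m + 1 < p \<and> p \<le> 2 * m + 1}"
    have fin: "finite B"
      by (rule finite_subset[of _ "{..2 * m + 1}"]) (auto simp: B_def)
    have split: "primes_le n = primes_le (m + 1) \<union> B"
      using 4 by (auto simp: primes_le_def B_def)
    have "\<Prod>B dvd (2 * m + 1) choose m"
    proof (rule prod_primes_dvdI)
      fix p assume p: "p \<in> B"
      then have "p dvd fact (2 * m + 1)"
        by (auto simp: B_def prime_dvd_fact_iff simp del: fact_Suc)
      also have "(fact (2 * m + 1) :: nat) = fact m * fact (m + 1) * ((2 * m + 1) choose m)"
        using binomial_fact_lemma[of m "2 * m + 1"] by simp
      finally show "p dvd (2 * m + 1) choose m"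
        using p by (auto simp: B_def prime_dvd_mult_iff prime_dvd_fact_iff simp del: fact_Suc)
    qed (use fin in \<open>auto simp: B_def\<close>)
    moreover have "(2 * m + 1) choose m > 0"
      by (simp)
    ultimately have "\<Prod>B \<le> (2 * m + 1) choose m"
      by (rule dvd_imp_le)
    also have "\<dots> \<le> (\<Sum>k\<le>m. (2 * m + 1) choose k)"
      by (rule member_le_sum) auto
    also have "\<dots> = 4 ^ m"
      using binomial_r_part_sum[of m] by (simp add: power_mult)
    finally have B: "\<Prod>B \<le> 4 ^ m" .
    have "\<Prod>(primes_le n) = \<Prod>(primes_le (m + 1)) * \<Prod>B"
      unfolding split by (rule prod.union_disjoint) (use fin in \<open>auto simp: primes_le_def B_def\<close>)
    also have "\<dots> \<le> 4 ^ (m + 1) * 4 ^ m"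
      using less.IH[of "m + 1"] 4 B by (intro mult_mono) auto
    also have "\<dots> = 4 ^ n"
      using 4 by (simp add: mult_2 power_add)
    finally show ?thesis .
  qed
qed

lemma ln_4_le: "ln (4::real) \<le> 2"
proof -
  have "ln (4::real) = 2 * ln 2"
    using ln_realpow[of 2 2] by simp
  then show ?thesis using ln_2_less_1 by linarith
qed

lemma ln_4_ge: "ln (4::real) \<ge> 1"
proof -
  have "exp 1 \<le> (4::real)" using exp_le by linarith
  then show ?thesis by (subst ln_ge_iff) auto
qed

text \<open>
  Each prime above \<open>\<surd>n\<close> contributes at least half of \<open>ln n\<close> to the logarithm of the primorial, and
  there are at most \<open>\<surd>n\<close> other primes.
\<close>

lemma card_primes_le_upper:
  assumes "n \<ge> 1"
  shows "real (card (primes_le n)) * ln (real n) \<le> 6 * real n"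
proof -
  define s where "s = sqrt (real n)"
  define B where "B = {p \<in> primes_le n. s < real p}"
  have s: "s \<ge> 1" "s * s = real n"
    using assms by (auto simp: s_def)
  have ln_n: "ln (real n) = 2 * ln s"
    using s(1) ln_mult_pos[of s s] unfolding s(2) by simp
  have "(\<Prod>p\<in>primes_le n. real p) \<le> 4 ^ n"
    using of_nat_mono[OF primorial_le[of n], where ?'a = real] by (simp add: of_nat_prod)
  then have "ln (\<Prod>p\<in>primes_le n. real p) \<le> ln (4 ^ n)"
    by (subst ln_le_cancel_iff) (auto intro!: prod_pos simp: primes_le_def prime_gt_0_nat)
  then have theta: "(\<Sum>p\<in>primes_le n. ln (real p)) \<le> real n * ln 4"
    by (subst (asm) ln_prod) (auto simp: ln_realpow primes_le_def prime_gt_0_nat)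
  have "real (card B) * ln s = (\<Sum>p\<in>B. ln s)" by simp
  also have "\<dots> \<le> (\<Sum>p\<in>B. ln (real p))"
    using s by (intro sum_mono) (auto simp: B_def)
  also have "\<dots> \<le> (\<Sum>p\<in>primes_le n. ln (real p))"
    by (intro sum_mono2) (auto simp: B_def primes_le_def dest: prime_gt_0_nat)
  also have "\<dots> \<le> real n * 2"
    using theta ln_4_le by (meson mult_left_mono of_nat_0_le_iff order_trans)
  finally have 1: "real (card B) * ln s \<le> 2 * real n" by simp
  have "real (card (primes_le n - B)) \<le> s"
  proof -
    have "primes_le n - B \<subseteq> {1..nat \<lfloor>s\<rfloor>}"
      by (auto simp: B_def primes_le_def Suc_le_eq prime_gt_0_nat not_less intro!: le_nat_floor)
    then have "card (primes_le n - B) \<le> nat \<lfloor>s\<rfloor>"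
      using card_mono[of "{1..nat \<lfloor>s\<rfloor>}"] by fastforce
    then show ?thesis using s(1) by linarith
  qed
  moreover have "ln s \<le> s" "ln s \<ge> 0" using s(1) by (auto simp: ln_bound)
  ultimately have 2: "real (card (primes_le n - B)) * ln s \<le> real n"
    using mult_mono[of "real (card (primes_le n - B))" s "ln s" s] s by simp
  have "card (primes_le n) = card B + card (primes_le n - B)"
    by (subst card_Un_disjoint[symmetric]) (auto simp: B_def intro!: arg_cong[of _ _ card])
  then have "real (card (primes_le n)) * ln s \<le> 3 * real n"
    using 1 2 by (simp add: distrib_right)
  then show ?thesis unfolding ln_n by linarith
qed

text \<open>
  The numbers \<open>1 / ((n + 1) (n choose k))\<close> form Leibniz's harmonic triangle, in which every entry
  is the difference of two entries with smaller \<open>k\<close>. Hence a common multiple of the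
  denominators on the edge, which are \<open>1, \<dots>, n + 1\<close>, clears all of them.
\<close>

lemma leibniz_triangle_dvd:
  fixes L :: nat
  assumes "\<And>m. 1 \<le> m \<Longrightarrow> m \<le> n + 1 \<Longrightarrow> m dvd L" "k \<le> n"
  shows "(n + 1) * (n choose k) dvd L"
  using assms
proof (induction k arbitrary: n)
  case 0
  then show ?case by simp
next
  case (Suc k)
  from Suc.IH[of n] Suc.prems obtain a where a: "L = (n + 1) * (n choose k) * a"
    by (metis Suc_leD dvd_def)
  have "Suc (n - 1) * ((n - 1) choose k) dvd L"
    using Suc.IH[of "n - 1"] Suc.prems by simp
  moreover have "Suc (n - 1) = n" using Suc.prems by simp
  ultimately obtain b where b: "L = n * ((n - 1) choose k) * b"
    by (metis dvd_def)
  have 1: "Suc k * (n choose Suc k) = (n - k) * (n choose k)"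
    by (metis binomial_absorption binomial_absorb_comp)
  have 2: "n * ((n - 1) choose k) = (n - k) * (n choose k)"
    by (simp add: binomial_absorb_comp)
  have k: "int (n - k) = int n - int k" using Suc.prems by simp
  have absorb: "(int k + 1) * int (n choose Suc k) = (int n - int k) * int (n choose k)"
    using arg_cong[OF 1, of int] k by (simp add: algebra_simps)
  have a': "int L = (int n + 1) * int (n choose k) * int a"
    using arg_cong[OF a, of int] by (simp add: algebra_simps)
  have b': "int L = (int k + 1) * int (n choose Suc k) * int b"
    using arg_cong[OF b, of int] 1 2 by (metis (no_types) absorb k of_nat_mult)
  have "(int k + 1) * ((int n + 1) * int (n choose Suc k) * (int b - int a))
      = (int n + 1) * ((int k + 1) * int (n choose Suc k) * int b)
        - (int n + 1) * int a * ((int k + 1) * int (n choose Suc k))"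
    by (simp add: algebra_simps)
  also have "\<dots> = (int n + 1) * int L - (int n - int k) * int L"
    unfolding b'[symmetric] unfolding absorb using a' by (simp add: algebra_simps)
  also have "\<dots> = (int k + 1) * int L"
    by (simp add: algebra_simps)
  finally have "int L = (int n + 1) * int (n choose Suc k) * (int b - int a)"
    by simp
  then have "int ((n + 1) * (n choose Suc k)) dvd int L"
    by (metis dvd_triv_left of_nat_1 of_nat_add of_nat_mult)
  then show ?case
    by (simp only: int_dvd_int_iff)
qed

text \<open>
  For \<open>N = 2 m + 1\<close>, the product \<open>L\<close> of the largest powers \<open>p ^ e \<le> N\<close> of the primes \<open>p \<le> N\<close> is a
  common multiple of \<open>1, \<dots>, N\<close>. It is at most \<open>N ^ \<pi>(N)\<close>, factor by factor, and at least \<open>4 ^ m\<close>,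
  because it is divisible by \<open>N\<close> times the central binomial coefficient.
\<close>

lemma power4_le_power_card_primes_le: "4 ^ m \<le> (2 * m + 1) ^ card (primes_le (2 * m + 1))"
proof -
  define N where "N = 2 * m + 1"
  define e where "e = (\<lambda>p. Max {e. p ^ e \<le> N})"
  define L where "L = (\<Prod>p\<in>primes_le N. p ^ e p)"
  have fin: "finite {e. p ^ e \<le> N}" if "prime p" for p
  proof (rule finite_subset[of _ "{..N}"])
    show "{e. p ^ e \<le> N} \<subseteq> {..N}"
    proof safe
      fix e assume "p ^ e \<le> N"
      moreover have "e < p ^ e" using that prime_gt_1_nat by (intro power_gt_expt) auto
      ultimately show "e \<le> N" by simp
    qed
  qed simp
  have e: "p ^ e p \<le> N" if "prime p" for p
  proof -
    have "e p \<in> {e. p ^ e \<le> N}" unfolding e_def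
      using fin[OF that] by (intro Max_in) (auto simp: N_def intro!: exI[of _ 0])
    then show ?thesis by simp
  qed
  have dvd: "k dvd L" if k: "1 \<le> k" "k \<le> N" for k
  proof -
    have "k = (\<Prod>p\<in>prime_factors k. p ^ multiplicity p k)"
      using k by (simp add: prime_factorization_nat)
    also have "\<dots> dvd (\<Prod>p\<in>prime_factors k. p ^ e p)"
    proof (rule prod_dvd_prod)
      fix p assume p: "p \<in> prime_factors k"
      have "p ^ multiplicity p k \<le> k"
        using k by (intro dvd_imp_le multiplicity_dvd) auto
      then have "multiplicity p k \<le> e p" unfolding e_def
        using p k by (intro Max_ge fin) auto
      then show "p ^ multiplicity p k dvd p ^ e p"
        by (rule le_imp_power_dvd)
    qed
    also have "\<dots> dvd L" unfolding L_def
    proof (rule prod_dvd_prod_subset)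
      show "prime_factors k \<subseteq> primes_le N"
        using k by (auto simp: primes_le_def in_prime_factors_iff dest!: dvd_imp_le)
    qed auto
    finally show ?thesis .
  qed
  have pos: "L > 0" unfolding L_def
    by (intro prod_pos) (auto simp: primes_le_def prime_gt_0_nat)
  have "N * ((2 * m) choose m) dvd L"
    using leibniz_triangle_dvd[of "2 * m" L m] dvd by (simp add: N_def)
  then have "N * ((2 * m) choose m) \<le> L"
    using pos by (rule dvd_imp_le)
  moreover have "4 ^ m \<le> N * ((2 * m) choose m)"
  proof -
    have "(4::nat) ^ m = (\<Sum>k\<le>2 * m. (2 * m) choose k)"
      by (simp add: choose_row_sum power_mult)
    also have "\<dots> \<le> (\<Sum>k\<le>2 * m. (2 * m) choose m)"
      by (intro sum_mono binomial_maximum')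
    finally show ?thesis by (simp add: N_def)
  qed
  moreover have "L \<le> (\<Prod>p\<in>primes_le N. N)" unfolding L_def
    by (intro prod_mono) (auto intro: e prime_primes_le)
  ultimately show ?thesis by (simp add: N_def)
qed

lemma card_primes_le_lower:
  assumes "n \<ge> 2"
  shows "real n / 4 \<le> real (card (primes_le n)) * ln (real n)"
proof (cases "n = 2")
  case True
  have "primes_le 2 = {2}"
    by (auto simp: primes_le_def) (metis le_antisym prime_ge_2_nat)
  moreover have "ln (2::real) \<ge> 1/2"
    using ln_4_ge ln_realpow[of 2 2] by simp
  ultimately show ?thesis using True by simp
next
  case False
  define m where "m = (n - 1) div 2"
  have m: "2 * m + 1 \<le> n" "n \<le> 4 * m" "m \<ge> 1"
    using assms False by (auto simp: m_def) presburger+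
  have "real m * 1 \<le> real m * ln 4"
    using ln_4_ge by (intro mult_left_mono) auto
  also have "\<dots> = ln (real (4 ^ m))"
    by (simp add: ln_realpow)
  also have "\<dots> \<le> ln (real ((2 * m + 1) ^ card (primes_le (2 * m + 1))))"
    using power4_le_power_card_primes_le[of m] by (intro ln_mono) (auto simp del: of_nat_power)
  also have "\<dots> = real (card (primes_le (2 * m + 1))) * ln (real (2 * m + 1))"
    by (simp add: ln_realpow)
  also have "\<dots> \<le> real (card (primes_le n)) * ln (real n)"
    using m by (intro mult_mono ln_mono of_nat_mono card_mono) (auto simp: primes_le_def)
  finally show ?thesis using m by linarith
qed

section \<open>The Selberg sieve\<close>

text \<open>
  Moebius inversion in the lattice of finite sets.
\<close>

lemma sum_signs_between:
  fixes J K :: "'a set"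
  assumes "finite K" "J \<subseteq> K"
  shows "(\<Sum>E | J \<subseteq> E \<and> E \<subseteq> K. (-1) ^ card E) = (if J = K then (-1) ^ card J else (0::real))"
proof -
  have fin: "finite J" using assms finite_subset by blast
  have "(\<Sum>E | J \<subseteq> E \<and> E \<subseteq> K. (-1) ^ card E) = (\<Sum>X\<in>Pow (K - J). (-1) ^ card J * (-1) ^ card X :: real)"
    using assms fin
    by (intro sum.reindex_bij_witness[of _ "\<lambda>X. J \<union> X" "\<lambda>E. E - J"])
       (auto simp: power_add[symmetric] card_Un_disjoint[symmetric] Un_absorb1
             intro!: arg_cong2[of _ _ _ _ "(^)"] arg_cong[of _ _ card]
             dest: finite_subset)
  also have "\<dots> = (-1) ^ card J * (\<Sum>X\<in>Pow (K - J). (\<Prod>x\<in>X. -1) * (\<Prod>x\<in>(K - J) - X. 1))"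
    by (simp add: sum_distrib_left)
  also have "\<dots> = (-1) ^ card J * (\<Prod>x\<in>K - J. (-1) + 1 :: real)"
    using assms by (subst prod_add) auto
  also have "\<dots> = (if J = K then (-1) ^ card J else 0)"
    using assms by (auto simp: prod_zero_iff)
  finally show ?thesis .
qed

text \<open>
  Selberg's minimisation, for a divisor-closed family \<open>D\<close> of moduli and a density \<open>1 / f p\<close> at each
  prime. Writing \<open>f\<close> of the intersection of \<open>A\<close> and \<open>B\<close> as a sum over its subsets
  diagonalises the quadratic form in the last conclusion: with \<open>h J = \<Prod>\<^bsub>p \<in> J\<^esub> 1 / (f p - 1)\<close> it equals \<open>\<Sum>\<^bsub>J\<^esub> y\<^sub>J\<^sup>2 / h J\<close>, where \<open>y\<^sub>J\<close> is the sum of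
  \<open>w A / \<Prod>\<^bsub>p \<in> A\<^esub> f p\<close> over the members \<open>A\<close> of \<open>D\<close> that contain \<open>J\<close>. Subject to \<open>w {} = 1\<close>, the minimum
  is attained for \<open>y\<^sub>J\<close> proportional to \<open>(-1) ^ card J * h J\<close>, and the weights are obtained from this by
  Moebius inversion.
\<close>

lemma selberg_weights:
  fixes f :: "'a \<Rightarrow> real" and D :: "'a set set"
  assumes fin: "finite P" and D: "D \<subseteq> Pow P" and down: "\<And>A B. A \<in> D \<Longrightarrow> B \<subseteq> A \<Longrightarrow> B \<in> D"
    and nonempty: "{} \<in> D" and f: "\<And>p. p \<in> P \<Longrightarrow> f p > 1"
  defines "G \<equiv> (\<Sum>A\<in>D. \<Prod>p\<in>A. 1 / (f p - 1))"
  obtains w :: "'a set \<Rightarrow> real"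
  where "w {} = 1"
    and "\<And>A. A \<in> D \<Longrightarrow> \<bar>w A\<bar> \<le> (\<Prod>p\<in>A. f p / (f p - 1))"
    and "(\<Sum>A\<in>D. \<Sum>B\<in>D. w A * w B / (\<Prod>p\<in>A \<union> B. f p)) = 1 / G"
proof -
  define h where "h = (\<lambda>A. \<Prod>p\<in>A. 1 / (f p - 1))"
  define F where "F = (\<lambda>A. \<Prod>p\<in>A. f p)"
  define w where "w = (\<lambda>A. (-1) ^ card A * F A * (\<Sum>K | K \<in> D \<and> A \<subseteq> K. h K) / G)"
  have finD: "finite D" using fin D by (meson finite_Pow_iff finite_subset)
  have finA: "finite A" if "A \<in> D" for A using that D fin finite_subset by blast
  have f': "f p > 1" if "A \<in> D" "p \<in> A" for A p using that D f by blast
  have h_pos: "h A > 0" if "A \<in> D" for A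
    unfolding h_def by (intro prod_pos) (use f' that in force)
  have F_pos: "F A > 0" if "A \<in> D" for A
    unfolding F_def by (intro prod_pos) (use f' that in force)
  have G_eq: "G = (\<Sum>A\<in>D. h A)" by (simp add: G_def h_def)
  have G_pos: "G > 0"
    unfolding G_eq using nonempty finD h_pos by (intro sum_pos) auto
  have w0: "w {} = 1"
    using G_pos by (simp add: w_def F_def G_eq)
  have w_bound: "\<bar>w A\<bar> \<le> (\<Prod>p\<in>A. f p / (f p - 1))" if A: "A \<in> D" for A
  proof -
    have "(\<Sum>K | K \<in> D \<and> A \<subseteq> K. h K) = (\<Sum>K | K \<in> D \<and> A \<subseteq> K. h A * h (K - A))"
    proof (rule sum.cong)
      fix K assume K: "K \<in> {K \<in> D. A \<subseteq> K}"
      then show "h K = h A * h (K - A)"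
        unfolding h_def using prod.subset_diff[of A K "\<lambda>p. 1 / (f p - 1)"] finA[of K]
        by (simp add: mult.commute)
    qed simp
    also have "\<dots> = h A * (\<Sum>X\<in>(\<lambda>K. K - A) ` {K \<in> D. A \<subseteq> K}. h X)"
      by (subst sum.reindex) (auto simp: sum_distrib_left inj_on_def)
    also have "\<dots> \<le> h A * G" unfolding G_eq
      using h_pos[OF A] down finD h_pos
      by (intro mult_left_mono sum_mono2) (auto intro: less_imp_le)
    finally have le: "(\<Sum>K | K \<in> D \<and> A \<subseteq> K. h K) \<le> h A * G" .
    have nn: "(\<Sum>K | K \<in> D \<and> A \<subseteq> K. h K) \<ge> 0"
      by (intro sum_nonneg) (auto intro: less_imp_le h_pos)
    have "\<bar>w A\<bar> = F A * (\<Sum>K | K \<in> D \<and> A \<subseteq> K. h K) / G"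
      using F_pos[OF A] G_pos nn by (simp add: w_def abs_mult power_abs)
    also have "\<dots> \<le> F A * (h A * G) / G"
      using F_pos[OF A] G_pos le by (intro divide_right_mono mult_left_mono) auto
    also have "\<dots> = (\<Prod>p\<in>A. f p / (f p - 1))"
      using G_pos by (simp add: F_def h_def prod.distrib[symmetric])
    finally show ?thesis .
  qed
  \<comment> \<open>Moebius inversion recovers the diagonal variable \<open>y\<^sub>J\<close> from the weights.\<close>
  have y: "(\<Sum>A | A \<in> D \<and> J \<subseteq> A. w A / F A) = (-1) ^ card J * h J / G" if J: "J \<in> D" for J
  proof -
    have "(\<Sum>A | A \<in> D \<and> J \<subseteq> A. w A / F A)
        = (\<Sum>A | A \<in> D \<and> J \<subseteq> A. \<Sum>K | K \<in> D \<and> A \<subseteq> K. (-1) ^ card A * h K / G)"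
    proof (intro sum.cong refl)
      fix A assume "A \<in> {A \<in> D. J \<subseteq> A}"
      then show "w A / F A = (\<Sum>K | K \<in> D \<and> A \<subseteq> K. (-1) ^ card A * h K / G)"
        using F_pos[of A] by (simp add: w_def sum_distrib_left sum_divide_distrib)
    qed
    also have "\<dots> = (\<Sum>K\<in>D. \<Sum>A | A \<in> D \<and> J \<subseteq> A \<and> A \<subseteq> K. (-1) ^ card A * h K / G)"
      using finD by (subst sum.swap_restrict) (auto intro!: sum.cong)
    also have "\<dots> = (\<Sum>K\<in>D. (if J = K then (-1) ^ card J * h J / G else 0))"
    proof (intro sum.cong refl)
      fix K assume K: "K \<in> D"
      have "(\<Sum>A | A \<in> D \<and> J \<subseteq> A \<and> A \<subseteq> K. (-1) ^ card A * h K / G)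
          = (\<Sum>A | J \<subseteq> A \<and> A \<subseteq> K. (-1) ^ card A) * (h K / G)"
        using down[OF K] by (subst sum_distrib_right) (auto intro!: sum.cong)
      also have "\<dots> = (if J = K then (-1) ^ card J * h J / G else 0)"
      proof (cases "J \<subseteq> K")
        case True
        then show ?thesis using sum_signs_between[OF finA[OF K]] by simp
      next
        case False
        then have none: "{A. J \<subseteq> A \<and> A \<subseteq> K} = {}" and neq: "J \<noteq> K" by blast+
        show ?thesis unfolding none sum.empty if_not_P[OF neq] by (rule mult_zero_left)
      qed
      finally show "(\<Sum>A | A \<in> D \<and> J \<subseteq> A \<and> A \<subseteq> K. (-1) ^ card A * h K / G)
          = (if J = K then (-1) ^ card J * h J / G else 0)" .
    qed
    also have "\<dots> = (-1) ^ card J * h J / G"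
      using J finD by (simp add: sum.delta')
    finally show ?thesis .
  qed
  have inter: "F (A \<inter> B) = (\<Sum>J | J \<in> D \<and> J \<subseteq> A \<and> J \<subseteq> B. 1 / h J)" if "A \<in> D" "B \<in> D" for A B
  proof -
    have AB: "A \<inter> B \<in> D" using down that by blast
    have "F (A \<inter> B) = (\<Prod>p\<in>A \<inter> B. (f p - 1) + 1)"
      by (simp add: F_def)
    also have "\<dots> = (\<Sum>J\<in>Pow (A \<inter> B). \<Prod>p\<in>J. f p - 1)"
      using finA[OF AB] by (subst prod_add) auto
    also have "\<dots> = (\<Sum>J | J \<in> D \<and> J \<subseteq> A \<and> J \<subseteq> B. 1 / h J)"
      using down[OF AB] by (intro sum.cong) (auto simp: h_def prod_dividef)
    finally show ?thesis .
  qed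
  have "(\<Sum>A\<in>D. \<Sum>B\<in>D. w A * w B / F (A \<union> B))
      = (\<Sum>A\<in>D. \<Sum>B\<in>D. \<Sum>J | J \<in> D \<and> J \<subseteq> A \<and> J \<subseteq> B. (w A / F A) * (w B / F B) / h J)"
  proof (intro sum.cong refl)
    fix A B assume AB: "A \<in> D" "B \<in> D"
    have "F (A \<union> B) * F (A \<inter> B) = F A * F B"
      unfolding F_def using finA AB by (simp add: prod.union_inter)
    moreover have "F (A \<inter> B) > 0" using F_pos AB down by blast
    ultimately have "F (A \<union> B) = F A * F B / F (A \<inter> B)"
      by (simp add: field_simps)
    then have "w A * w B / F (A \<union> B) = (w A / F A) * (w B / F B) * F (A \<inter> B)"
      by simp
    also have "\<dots> = (\<Sum>J | J \<in> D \<and> J \<subseteq> A \<and> J \<subseteq> B. (w A / F A) * (w B / F B) / h J)"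
      unfolding inter[OF AB] by (simp add: sum_distrib_left)
    finally show "w A * w B / F (A \<union> B)
        = (\<Sum>J | J \<in> D \<and> J \<subseteq> A \<and> J \<subseteq> B. (w A / F A) * (w B / F B) / h J)" .
  qed
  also have "\<dots> = (\<Sum>A\<in>D. \<Sum>B\<in>D. \<Sum>J\<in>D. if J \<subseteq> A \<and> J \<subseteq> B then (w A / F A) * (w B / F B) / h J else 0)"
    using finD by (simp add: sum.inter_filter[symmetric] Collect_conj_eq)
  also have "\<dots> = (\<Sum>J\<in>D. \<Sum>A\<in>D. \<Sum>B\<in>D. if J \<subseteq> A \<and> J \<subseteq> B then (w A / F A) * (w B / F B) / h J else 0)"
    by (subst (2) sum.swap, subst sum.swap) (rule refl)
  also have "\<dots> = (\<Sum>J\<in>D. (\<Sum>A | A \<in> D \<and> J \<subseteq> A. w A / F A)\<^sup>2 / h J)"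
  proof (intro sum.cong refl)
    fix J assume "J \<in> D"
    have "(\<Sum>A | A \<in> D \<and> J \<subseteq> A. w A / F A)\<^sup>2 / h J
        = (\<Sum>A\<in>D. \<Sum>B\<in>D. (if J \<subseteq> A then w A / F A else 0) * (if J \<subseteq> B then w B / F B else 0) / h J)"
      using finD by (simp add: sum.inter_filter power2_eq_square sum_product sum_divide_distrib)
    also have "\<dots> = (\<Sum>A\<in>D. \<Sum>B\<in>D. if J \<subseteq> A \<and> J \<subseteq> B then (w A / F A) * (w B / F B) / h J else 0)"
      by (intro sum.cong refl) auto
    finally show "(\<Sum>A\<in>D. \<Sum>B\<in>D. if J \<subseteq> A \<and> J \<subseteq> B then (w A / F A) * (w B / F B) / h J else 0)
        = (\<Sum>A | A \<in> D \<and> J \<subseteq> A. w A / F A)\<^sup>2 / h J" ..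
  qed
  also have "\<dots> = (\<Sum>J\<in>D. h J / G\<^sup>2)"
    using h_pos by (intro sum.cong refl) (simp add: y power_mult_distrib power_divide power2_eq_square less_imp_neq[symmetric])
  also have "\<dots> = 1 / G"
    using G_pos by (simp add: sum_divide_distrib[symmetric] G_eq[symmetric] power2_eq_square)
  finally have "(\<Sum>A\<in>D. \<Sum>B\<in>D. w A * w B / (\<Prod>p\<in>A \<union> B. f p)) = 1 / G"
    unfolding F_def .
  with w0 w_bound show ?thesis by (rule that)
qed

text \<open>
  Here \<open>hit n\<close> is the set of primes that remove \<open>n\<close>. The indicator function of the unsifted
  elements is at most the square of the sum of the weights of the \<open>A \<subseteq> hit n\<close>; this sum is
  \<open>w {} = 1\<close> when \<open>n\<close> is unsifted. Expanding the square and counting the \<open>n\<close> with \<open>A \<union> B \<subseteq> hit n\<close> leaves the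
  quadratic form of the weights as main term.
\<close>

theorem selberg_sieve:
  fixes f :: "'a \<Rightarrow> real" and D :: "'a set set" and S :: "'b set" and hit :: "'b \<Rightarrow> 'a set"
  assumes fin: "finite P" and D: "D \<subseteq> Pow P" and down: "\<And>A B. A \<in> D \<Longrightarrow> B \<subseteq> A \<Longrightarrow> B \<in> D"
    and nonempty: "{} \<in> D" and f: "\<And>p. p \<in> P \<Longrightarrow> f p > 1"
    and S: "finite S"
    and count: "\<And>A. A \<subseteq> P \<Longrightarrow> \<bar>real (card {n \<in> S. A \<subseteq> hit n}) - N / (\<Prod>p\<in>A. f p)\<bar> \<le> r A"
  shows "real (card {n \<in> S. hit n \<inter> P = {}}) \<le> N / (\<Sum>A\<in>D. \<Prod>p\<in>A. 1 / (f p - 1))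
    + (\<Sum>A\<in>D. \<Sum>B\<in>D. (\<Prod>p\<in>A. f p / (f p - 1)) * (\<Prod>p\<in>B. f p / (f p - 1)) * r (A \<union> B))"
proof -
  define G where "G = (\<Sum>A\<in>D. \<Prod>p\<in>A. 1 / (f p - 1))"
  define M where "M = (\<lambda>A. \<Prod>p\<in>A. f p / (f p - 1))"
  define F where "F = (\<lambda>A. \<Prod>p\<in>A. f p)"
  obtain w :: "'a set \<Rightarrow> real" where w0: "w {} = 1" and w_le: "\<And>A. A \<in> D \<Longrightarrow> \<bar>w A\<bar> \<le> M A"
    and w_quad: "(\<Sum>A\<in>D. \<Sum>B\<in>D. w A * w B / F (A \<union> B)) = 1 / G"
    
  proof (rule selberg_weights[of P D f])
    show "B \<in> D" if "A \<in> D" "B \<subseteq> A" for A B using that by (rule down)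
    show "f p > 1" if "p \<in> P" for p using that by (rule f)
  next
    fix w :: "'a set \<Rightarrow> real"
    assume "w {} = 1" "\<And>A. A \<in> D \<Longrightarrow> \<bar>w A\<bar> \<le> (\<Prod>p\<in>A. f p / (f p - 1))"
      "(\<Sum>A\<in>D. \<Sum>B\<in>D. w A * w B / (\<Prod>p\<in>A \<union> B. f p)) = 1 / (\<Sum>A\<in>D. \<Prod>p\<in>A. 1 / (f p - 1))"
    then show thesis
      by (intro that) (simp_all add: M_def G_def F_def)
  qed (use fin D nonempty in simp_all)
  have finD: "finite D" using fin D by (meson finite_Pow_iff finite_subset)
  define C where "C = (\<lambda>A. real (card {n \<in> S. A \<subseteq> hit n}))"
  have "real (card {n \<in> S. hit n \<inter> P = {}}) = (\<Sum>n\<in>S. if hit n \<inter> P = {} then 1 else 0)"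
    using S by (simp add: sum.inter_filter[symmetric])
  also have "\<dots> \<le> (\<Sum>n\<in>S. (\<Sum>A\<in>D. if A \<subseteq> hit n then w A else 0)\<^sup>2)"
  proof (rule sum_mono)
    fix n assume "n \<in> S"
    show "(if hit n \<inter> P = {} then 1 else 0) \<le> (\<Sum>A\<in>D. if A \<subseteq> hit n then w A else 0)\<^sup>2"
    proof (cases "hit n \<inter> P = {}")
      case True
      have "(\<Sum>A\<in>D. if A \<subseteq> hit n then w A else 0) = (\<Sum>A\<in>D. if A = {} then w A else 0)"
        using True D by (intro sum.cong refl) auto
      also have "\<dots> = 1" using finD nonempty w0 by (simp add: sum.delta)
      finally show ?thesis by simp
    qed simp
  qed
  also have "\<dots> = (\<Sum>n\<in>S. \<Sum>A\<in>D. \<Sum>B\<in>D. if A \<union> B \<subseteq> hit n then w A * w B else 0)"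
    unfolding power2_eq_square sum_product by (intro sum.cong refl) auto
  also have "\<dots> = (\<Sum>A\<in>D. \<Sum>B\<in>D. \<Sum>n\<in>S. if A \<union> B \<subseteq> hit n then w A * w B else 0)"
    by (subst sum.swap, subst (2) sum.swap) (rule refl)
  also have "\<dots> = (\<Sum>A\<in>D. \<Sum>B\<in>D. w A * w B * C (A \<union> B))"
    using S by (simp add: C_def sum.inter_filter[symmetric] mult.commute)
  also have "\<dots> \<le> (\<Sum>A\<in>D. \<Sum>B\<in>D. N * (w A * w B / F (A \<union> B)) + M A * M B * r (A \<union> B))"
  proof (intro sum_mono)
    fix A B assume AB: "A \<in> D" "B \<in> D"
    have c: "\<bar>C (A \<union> B) - N / F (A \<union> B)\<bar> \<le> r (A \<union> B)"
      unfolding C_def F_def using AB D by (intro count) auto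
    have "w A * w B * C (A \<union> B) - N * (w A * w B / F (A \<union> B)) = w A * w B * (C (A \<union> B) - N / F (A \<union> B))"
      by (simp add: algebra_simps)
    also have "\<dots> \<le> \<bar>w A\<bar> * \<bar>w B\<bar> * \<bar>C (A \<union> B) - N / F (A \<union> B)\<bar>"
      by (metis abs_ge_self abs_mult)
    also have "\<dots> \<le> M A * M B * r (A \<union> B)"
      using w_le AB c by (intro mult_mono mult_nonneg_nonneg) (auto intro: order_trans[OF abs_ge_zero])
    finally show "w A * w B * C (A \<union> B) \<le> N * (w A * w B / F (A \<union> B)) + M A * M B * r (A \<union> B)"
      by simp
  qed
  also have "\<dots> = N * (\<Sum>A\<in>D. \<Sum>B\<in>D. w A * w B / F (A \<union> B)) + (\<Sum>A\<in>D. \<Sum>B\<in>D. M A * M B * r (A \<union> B))"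
    by (simp add: sum.distrib sum_distrib_left)
  finally show ?thesis
    unfolding w_quad by (simp add: G_def M_def)
qed

section \<open>Local densities for the product of two shifted integers\<close>

lemma card_residue_class:
  fixes m t N :: nat
  assumes "t < m"
  shows "\<bar>real (card {n. n < N \<and> n mod m = t}) - real N / real m\<bar> \<le> 1"
proof -
  \<comment> \<open>The number of terms \<open>t, t + m, \<dots>\<close> below \<open>N\<close>, that is \<open>(N - t) / m\<close> rounded up.\<close>
  define K where "K = (N + m - 1 - t) div m"
  have m: "m > 0" using assms by simp
  have less_iff: "t + k * m < N \<longleftrightarrow> k < K" for k
  proof -
    have "k < K \<longleftrightarrow> Suc k * m \<le> N + m - 1 - t"
      unfolding K_def Suc_le_eq[symmetric] using m by (rule less_eq_div_iff_mult_less_eq)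
    also have "\<dots> \<longleftrightarrow> t + k * m < N"
      using assms by auto
    finally show ?thesis ..
  qed
  have "{n. n < N \<and> n mod m = t} = (\<lambda>k. t + k * m) ` {..<K}"
  proof safe
    fix n assume n: "n < N" "t = n mod m"
    then have "n = t + (n div m) * m" by simp
    with n less_iff[of "n div m"] show "n \<in> (\<lambda>k. n mod m + k * m) ` {..<K}"
      by (intro image_eqI[of _ _ "n div m"]) auto
  qed (use assms less_iff in auto)
  moreover have "inj_on (\<lambda>k. t + k * m) {..<K}"
    using m by (auto simp: inj_on_def)
  ultimately have card: "card {n. n < N \<and> n mod m = t} = K"
    by (simp add: card_image)
  have "real K * real m \<le> real (N + m - 1 - t)"
    unfolding K_def by (metis div_times_less_eq_dividend of_nat_le_iff of_nat_mult)
  then have 1: "real K * real m \<le> real N + real m"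
    by linarith
  have "\<not> t + K * m < N" using less_iff by simp
  then have "real N \<le> real t + real K * real m"
    by (metis not_less of_nat_add of_nat_le_iff of_nat_mult)
  then have 2: "real N \<le> real m + real K * real m"
    using assms by linarith
  show ?thesis
    unfolding card using 1 2 m by (simp add: abs_le_iff field_simps)
qed

text \<open>
  By the Chinese remainder theorem the two conditions define one residue class modulo \<open>a * b\<close>.
\<close>

lemma card_coprime_divisor_pair:
  fixes a b d N :: nat
  assumes "coprime a b" "a > 0" "b > 0"
  shows "\<bar>real (card {n. n < N \<and> a dvd n \<and> b dvd n + d}) - real N / real (a * b)\<bar> \<le> 1"
proof -
  \<comment> \<open>A natural number congruent to \<open>- d\<close> modulo \<open>b\<close>.\<close>
  define u where "u = b * d - d"
  have u: "u + d = b * d" using assms(3) by (simp add: u_def)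
  obtain x where x: "[x = 0] (mod a)" "[x = u] (mod b)"
    using binary_chinese_remainder_nat[OF assms(1)] by blast
  have "a dvd n \<and> b dvd n + d \<longleftrightarrow> n mod (a * b) = x mod (a * b)" for n
  proof -
    have "a dvd n \<longleftrightarrow> [n = x] (mod a)"
      using x(1) by (metis cong_0_iff cong_sym cong_trans)
    moreover have "b dvd n + d \<longleftrightarrow> [n + d = u + d] (mod b)"
      unfolding u by (metis cong_0_iff cong_sym cong_trans dvd_triv_left)
    moreover have "\<dots> \<longleftrightarrow> [n = x] (mod b)"
      using x(2) by (metis cong_add_rcancel_nat cong_sym cong_trans)
    moreover have "[n = x] (mod a) \<and> [n = x] (mod b) \<longleftrightarrow> [n = x] (mod (a * b))"
      using assms(1) by (metis coprime_cong_mult_nat cong_modulus_mult_nat mult.commute)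
    ultimately show ?thesis by (simp add: unique_euclidean_semiring_class.cong_def)
  qed
  then have "{n. n < N \<and> a dvd n \<and> b dvd n + d} = {n. n < N \<and> n mod (a * b) = x mod (a * b)}"
    by auto
  then show ?thesis
    using card_residue_class[of "x mod (a * b)" "a * b" N] assms by simp
qed

text \<open>
  Since no \<open>p \<in> A\<close> divides \<open>d\<close>, each \<open>p\<close> divides exactly one of \<open>n\<close> and \<open>n + d\<close>. So \<open>A\<close> splits
  uniquely into the primes \<open>B\<close> dividing \<open>n\<close> and the others, and each of the \<open>2 ^ card A\<close> splittings
  contributes one residue class modulo \<open>\<Prod>A\<close>, counted with an error of at most 1.
\<close>

lemma card_local_shifted_product:
  fixes A :: "nat set" and d N :: nat
  assumes A: "finite A" "\<And>p. p \<in> A \<Longrightarrow> prime p" "\<And>p. p \<in> A \<Longrightarrow> \<not> p dvd d"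
  shows "\<bar>real (card {n. n < N \<and> (\<forall>p\<in>A. p dvd n * (n + d))}) - real N / (\<Prod>p\<in>A. real p / 2)\<bar> \<le> 2 ^ card A"
proof -
  define T where "T = (\<lambda>B. {n. n < N \<and> \<Prod>B dvd n \<and> \<Prod>(A - B) dvd n + d})"
  have finT: "finite (T B)" for B by (simp add: T_def)
  have dvd_iff: "\<Prod>B dvd m \<longleftrightarrow> (\<forall>p\<in>B. p dvd m)" if "B \<subseteq> A" for B m
    using that A(2) finite_subset[OF that A(1)] by (intro prod_primes_dvd_iff) auto
  have "{n. n < N \<and> (\<forall>p\<in>A. p dvd n * (n + d))} = (\<Union>B\<in>Pow A. T B)"
  proof (intro set_eqI iffI)
    fix n assume n: "n \<in> {n. n < N \<and> (\<forall>p\<in>A. p dvd n * (n + d))}"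
    have "\<Prod>{p \<in> A. p dvd n} dvd n" using dvd_iff[of "{p \<in> A. p dvd n}" n] by auto
    moreover have "\<forall>p\<in>A - {p \<in> A. p dvd n}. p dvd n + d"
      using n A(2) by (auto simp: prime_dvd_mult_iff)
    then have "\<Prod>(A - {p \<in> A. p dvd n}) dvd n + d"
      using dvd_iff[of "A - {p \<in> A. p dvd n}" "n + d"] by blast
    ultimately have "n \<in> T {p \<in> A. p dvd n}" using n by (simp add: T_def)
    then show "n \<in> (\<Union>B\<in>Pow A. T B)" by (rule UN_I[rotated]) simp
  next
    fix n assume "n \<in> (\<Union>B\<in>Pow A. T B)"
    then obtain B where B: "B \<subseteq> A" and n: "n < N" "\<Prod>B dvd n" "\<Prod>(A - B) dvd n + d"
      unfolding T_def by blast
    have "\<forall>p\<in>B. p dvd n" "\<forall>p\<in>A - B. p dvd n + d"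
      using dvd_iff[OF B, of n] dvd_iff[of "A - B" "n + d"] n(2,3) by simp_all
    then have "\<forall>p\<in>A. p dvd n * (n + d)"
      by (metis DiffI dvd_mult dvd_mult2)
    then show "n \<in> {n. n < N \<and> (\<forall>p\<in>A. p dvd n * (n + d))}"
      using n(1) by simp
  qed
  moreover have "T B \<inter> T B' = {}" if BB: "B \<in> Pow A" "B' \<in> Pow A" "B \<noteq> B'" for B B'
  proof -
    \<comment> \<open>A prime on which the two splittings disagree would divide both \<open>n\<close> and \<open>n + d\<close>.\<close>
    have *: False if "n \<in> T B" "n \<in> T B'" "p \<in> B" "p \<notin> B'" "B \<subseteq> A" "B' \<subseteq> A" for B B' n p
    proof -
      have "\<Prod>B dvd n" "\<Prod>(A - B') dvd n + d" using that by (auto simp: T_def)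
      then have "p dvd n" "p dvd n + d" using that dvd_iff[of B n] dvd_iff[of "A - B'" "n + d"] by auto
      then have "p dvd d" by (metis dvd_add_right_iff)
      then show False using A(3) that by blast
    qed
    from BB consider p where "p \<in> B" "p \<notin> B'" | p where "p \<in> B'" "p \<notin> B"
      by blast
    then show ?thesis using *[of _ B B'] *[of _ B' B] BB(1,2) by cases auto
  qed
  ultimately have card: "card {n. n < N \<and> (\<forall>p\<in>A. p dvd n * (n + d))} = (\<Sum>B\<in>Pow A. card (T B))"
    using A(1) finT by (simp add: card_UN_disjoint)
  have main: "real N / (\<Prod>p\<in>A. real p / 2) = (\<Sum>B\<in>Pow A. real N / real (\<Prod>B * \<Prod>(A - B)))"
  proof -
    have "(\<Sum>B\<in>Pow A. real N / real (\<Prod>B * \<Prod>(A - B))) = (\<Sum>B\<in>Pow A. real N / real (\<Prod>A))"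
      using A(1) by (intro sum.cong refl) (metis PowD mult.commute prod.subset_diff)
    then show ?thesis
      using A(1) by (simp add: card_Pow prod_dividef)
  qed
  have "\<bar>real (card (T B)) - real N / real (\<Prod>B * \<Prod>(A - B))\<bar> \<le> 1" if B: "B \<in> Pow A" for B
  proof -
    have fin: "finite B" "finite (A - B)" using B A(1) finite_subset by auto
    have "coprime (\<Prod>B) (\<Prod>(A - B))"
    proof (intro prod_coprime_left prod_coprime_right)
      fix p q assume "p \<in> B" "q \<in> A - B"
      then show "coprime p q" using B A(2) by (intro primes_coprime) auto
    qed
    then show ?thesis unfolding T_def
      using B A(2) by (intro card_coprime_divisor_pair prod_pos) (auto simp: prime_gt_0_nat)
  qed
  then have "(\<Sum>B\<in>Pow A. \<bar>real (card (T B)) - real N / real (\<Prod>B * \<Prod>(A - B))\<bar>) \<le> (\<Sum>B\<in>Pow A. 1)"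
    by (rule sum_mono)
  also have "\<dots> = 2 ^ card A" using A(1) by (simp add: card_Pow)
  finally have "\<bar>\<Sum>B\<in>Pow A. real (card (T B)) - real N / real (\<Prod>B * \<Prod>(A - B))\<bar> \<le> 2 ^ card A"
    by (rule order_trans[OF sum_abs])
  then show ?thesis
    unfolding card main by (simp only: sum_subtractf of_nat_sum)
qed

section \<open>A lower bound for the Selberg sum\<close>

text \<open>
  Each element of \<open>C\<close> lies in \<open>A\<close> only, in \<open>B\<close> only, or in both.
\<close>

lemma sum_prod_union_eq:
  fixes u :: "'a \<Rightarrow> real"
  assumes "finite C"
  shows "(\<Sum>(A, B) | A \<union> B = C. prod u A * prod u B) = (\<Prod>p\<in>C. 2 * u p + (u p)\<^sup>2)"
proof -
  have "(\<Sum>(A, B) | A \<union> B = C. prod u A * prod u B)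
      = (\<Sum>(A, X)\<in>(SIGMA A:Pow C. Pow A). prod u A * (prod u (C - A) * prod u X))"
  proof (intro sum.reindex_bij_witness[of _ "\<lambda>(A, X). (A, (C - A) \<union> X)" "\<lambda>(A, B). (A, A \<inter> B)"])
    fix AB assume "AB \<in> {(A, B). A \<union> B = C}"
    then obtain A B where AB: "AB = (A, B)" "A \<union> B = C" by blast
    then have fin: "finite A" "finite B" using assms by auto
    have "B = (C - A) \<union> (A \<inter> B)" "(C - A) \<inter> (A \<inter> B) = {}" using AB by auto
    then have "prod u B = prod u (C - A) * prod u (A \<inter> B)"
      using fin assms by (metis finite_Diff finite_Int prod.union_disjoint)
    then show "(case case AB of (A, B) \<Rightarrow> (A, A \<inter> B) of (A, X) \<Rightarrow> prod u A * (prod u (C - A) * prod u X))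
      = (case AB of (A, B) \<Rightarrow> prod u A * prod u B)" by (simp add: AB)
  qed auto
  also have "\<dots> = (\<Sum>A\<in>Pow C. \<Sum>X\<in>Pow A. prod u A * (prod u (C - A) * prod u X))"
    using assms by (subst sum.Sigma) (auto intro: finite_subset)
  also have "\<dots> = (\<Sum>A\<in>Pow C. (\<Prod>p\<in>A. u p * (1 + u p)) * (\<Prod>p\<in>C - A. u p))"
  proof (intro sum.cong refl)
    fix A assume "A \<in> Pow C"
    then have fin: "finite A" using assms finite_subset by blast
    have "(\<Sum>X\<in>Pow A. prod u X) = (\<Prod>p\<in>A. u p + 1)"
      using prod_add[OF fin, of u "\<lambda>_. 1"] by simp
    then show "(\<Sum>X\<in>Pow A. prod u A * (prod u (C - A) * prod u X)) = (\<Prod>p\<in>A. u p * (1 + u p)) * (\<Prod>p\<in>C - A. u p)"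
      by (simp add: sum_distrib_left[symmetric] prod.distrib add.commute)
  qed
  also have "\<dots> = (\<Prod>p\<in>C. u p * (1 + u p) + u p)"
    using assms by (simp add: prod_add)
  also have "\<dots> = (\<Prod>p\<in>C. 2 * u p + (u p)\<^sup>2)"
    by (intro prod.cong refl) (simp add: algebra_simps power2_eq_square)
  finally show ?thesis .
qed

text \<open>
  The set version of multiplying two Dirichlet polynomials: this turns a bound for a sum of
  dimension one into a bound for a sum of dimension two.
\<close>

lemma sum_prod_squared_le:
  fixes u :: "'a \<Rightarrow> real"
  assumes fin: "finite E" "finite D" "\<And>C. C \<in> D \<Longrightarrow> finite C"
    and closed: "\<And>A B. A \<in> E \<Longrightarrow> B \<in> E \<Longrightarrow> A \<union> B \<in> D"
    and nonneg: "\<And>C p. C \<in> D \<Longrightarrow> p \<in> C \<Longrightarrow> u p \<ge> 0"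
  shows "(\<Sum>A\<in>E. prod u A)\<^sup>2 \<le> (\<Sum>C\<in>D. \<Prod>p\<in>C. 2 * u p + (u p)\<^sup>2)"
proof -
  have "(\<Sum>A\<in>E. prod u A)\<^sup>2 = (\<Sum>(A, B)\<in>E \<times> E. prod u A * prod u B)"
    by (simp add: power2_eq_square sum_product sum.cartesian_product)
  also have "\<dots> = (\<Sum>C\<in>D. \<Sum>(A, B) | (A, B) \<in> E \<times> E \<and> A \<union> B = C. prod u A * prod u B)"
    using fin closed
    by (subst sum.group[symmetric, where T = D and g = "\<lambda>(A, B). A \<union> B"]) (auto simp: case_prod_unfold mem_Times_iff)
  also have "\<dots> \<le> (\<Sum>C\<in>D. \<Sum>(A, B) | A \<union> B = C. prod u A * prod u B)"
  proof (intro sum_mono sum_mono2)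
    fix C assume C: "C \<in> D"
    show "finite {(A, B). A \<union> B = C}"
      by (rule finite_subset[of _ "Pow C \<times> Pow C"]) (use fin(3)[OF C] in auto)
    fix AB assume "AB \<in> {(A, B). A \<union> B = C} - {(A, B). (A, B) \<in> E \<times> E \<and> A \<union> B = C}"
    then show "0 \<le> (case AB of (A, B) \<Rightarrow> prod u A * prod u B)"
      using nonneg[OF C] by (auto intro!: mult_nonneg_nonneg prod_nonneg)
  qed auto
  also have "\<dots> = (\<Sum>C\<in>D. \<Prod>p\<in>C. 2 * u p + (u p)\<^sup>2)"
    using fin(3) by (intro sum.cong refl sum_prod_union_eq)
  finally show ?thesis .
qed

lemma sum_inverse_powers_le:
  fixes p :: nat
  assumes "p \<ge> 2"
  shows "(\<Sum>k=1..z. (1 / real p) ^ k) \<le> 1 / (real p - 1)"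
proof -
  have "(\<Sum>k=1..z. (1 / real p) ^ k) = (1 - (1 / real p) ^ z) / (real p - 1)"
  proof (induction z)
    case (Suc z)
    have "(1 / real p) ^ Suc z * (real p - 1) = (1 / real p) ^ z - (1 / real p) ^ Suc z"
      using assms by (simp add: diff_divide_distrib algebra_simps)
    moreover have "(1 - a) / c + b = (1 - b) / c" if "b * c = a - b" "c \<noteq> 0" for a b c :: real
      using that by (simp add: field_simps)
    ultimately have "(1 - (1 / real p) ^ z) / (real p - 1) + (1 / real p) ^ Suc z = (1 - (1 / real p) ^ Suc z) / (real p - 1)"
      using assms by auto
    then show ?case
      using Suc by (simp del: power_Suc)
  qed simp
  also have "\<dots> \<le> 1 / (real p - 1)"
    using assms by (intro divide_right_mono) auto
  finally show ?thesis .
qed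

text \<open>
  Expanding each \<open>1 / (p - 1)\<close> as the geometric series of the positive powers of \<open>1 / p\<close>, the right
  side is the sum of \<open>1 / n\<close> over all \<open>n\<close> whose set of prime factors is \<open>A\<close>.
\<close>

lemma sum_inverse_same_prime_factors_le:
  fixes A :: "nat set"
  assumes A: "\<And>p. p \<in> A \<Longrightarrow> prime p" "finite A"
  shows "(\<Sum>n | n \<in> {1..z} \<and> prime_factors n = A. 1 / real n) \<le> (\<Prod>p\<in>A. 1 / (real p - 1))"
proof -
  define M where "M = {n \<in> {1..z}. prime_factors n = A}"
  define e where "e = (\<lambda>n. restrict (\<lambda>p. multiplicity p n) A)"
  have n_eq: "n = (\<Prod>p\<in>A. p ^ multiplicity p n)" if "n \<in> M" for n
    using that prime_factorization_nat[of n] by (auto simp: M_def)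
  have inj: "inj_on e M"
  proof (rule inj_onI)
    fix m n assume mn: "m \<in> M" "n \<in> M" "e m = e n"
    then have "multiplicity p m = multiplicity p n" if "p \<in> A" for p
      using that unfolding e_def by (metis restrict_apply')
    then show "m = n" using n_eq[OF mn(1)] n_eq[OF mn(2)] by simp
  qed
  have e_mem: "e n \<in> PiE A (\<lambda>_. {1..z})" if n: "n \<in> M" for n
  proof -
    have "multiplicity p n \<in> {1..z}" if p: "p \<in> A" for p
    proof -
      have "p \<in> prime_factors n" using n p by (simp add: M_def)
      then have 1: "multiplicity p n \<ge> 1"
        by (simp add: prime_factors_multiplicity)
      have "multiplicity p n < p ^ multiplicity p n"
        using prime_gt_1_nat[OF A(1)[OF p]] by (intro power_gt_expt) simp
      also have "\<dots> \<le> n"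
        using n by (intro dvd_imp_le multiplicity_dvd) (auto simp: M_def)
      finally show ?thesis using 1 n by (auto simp: M_def)
    qed
    then show ?thesis by (auto simp: e_def)
  qed
  have "(\<Sum>n\<in>M. 1 / real n) = (\<Sum>n\<in>M. \<Prod>p\<in>A. (1 / real p) ^ e n p)"
  proof (intro sum.cong refl)
    fix n assume "n \<in> M"
    then have "real n = (\<Prod>p\<in>A. real p ^ e n p)"
      by (subst n_eq) (auto simp: e_def)
    then show "1 / real n = (\<Prod>p\<in>A. (1 / real p) ^ e n p)"
      by (simp add: power_one_over prod_dividef)
  qed
  also have "\<dots> = (\<Sum>g\<in>e ` M. \<Prod>p\<in>A. (1 / real p) ^ g p)"
    using inj by (simp add: sum.reindex)
  also have "\<dots> \<le> (\<Sum>g\<in>PiE A (\<lambda>_. {1..z}). \<Prod>p\<in>A. (1 / real p) ^ g p)"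
    using e_mem A(2) by (intro sum_mono2 finite_PiE prod_nonneg) auto
  also have "\<dots> = (\<Prod>p\<in>A. \<Sum>k=1..z. (1 / real p) ^ k)"
    using A(2) by (simp add: prod_sum_PiE)
  also have "\<dots> \<le> (\<Prod>p\<in>A. 1 / (real p - 1))"
    using A(1) by (intro prod_mono conjI sum_nonneg sum_inverse_powers_le) (auto simp: prime_ge_2_nat)
  finally show ?thesis by (simp add: M_def)
qed

text \<open>
  The squarefree numbers up to \<open>z\<close>, each given by its set of prime factors.
\<close>

definition prime_sets :: "nat \<Rightarrow> nat set set" where
  "prime_sets z = {A. A \<subseteq> primes_le z \<and> \<Prod>A \<le> z}"

lemma finite_prime_sets [simp, intro]: "finite (prime_sets z)"
  by (rule finite_subset[of _ "Pow (primes_le z)"]) (auto simp: prime_sets_def)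

lemma prime_setsD:
  assumes "A \<in> prime_sets z"
  shows "finite A" "\<And>p. p \<in> A \<Longrightarrow> prime p" "\<Prod>A \<le> z"
  using assms finite_subset[OF _ finite_primes_le] by (auto simp: prime_sets_def primes_le_def)

lemma prime_sets_subset:
  assumes "A \<in> prime_sets z" "B \<subseteq> A"
  shows "B \<in> prime_sets z"
proof -
  have "\<Prod>B dvd \<Prod>A" "\<Prod>A > 0"
    using prime_setsD[OF assms(1)] assms(2) by (auto intro!: prod_dvd_prod_subset prod_pos prime_gt_0_nat)
  then show ?thesis
    using assms dvd_imp_le[of "\<Prod>B" "\<Prod>A"] by (auto simp: prime_sets_def)
qed

text \<open>
  The right side dominates the harmonic sum: group the \<open>n \<le> z\<close> by their sets of prime factors.
\<close>

lemma ln_le_sum_prime_sets: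
  "ln (real z + 1) \<le> (\<Sum>A\<in>prime_sets z. \<Prod>p\<in>A. 1 / (real p - 1))"
proof -
  have "ln (real z + 1) \<le> (\<Sum>n\<in>{1..z}. 1 / real n)"
    using ln_le_harm[of z] by (simp add: harm_def field_simps)
  also have "\<dots> = (\<Sum>A\<in>prime_sets z. \<Sum>n | n \<in> {1..z} \<and> prime_factors n = A. 1 / real n)"
  proof (subst sum.group[where g = prime_factors])
    show "prime_factors ` {1..z} \<subseteq> prime_sets z"
    proof clarify
      fix n assume n: "n \<in> {1..z}"
      have "\<Prod>(prime_factors n) dvd n" by (rule prod_primes_dvdI) auto
      then have "\<Prod>(prime_factors n) \<le> z" using n by (auto dest: dvd_imp_le)
      moreover have "prime_factors n \<subseteq> primes_le z"
      proof
        fix p assume "p \<in> prime_factors n"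
        then have "prime p" "p \<le> n" using n by (auto simp: in_prime_factors_iff intro: dvd_imp_le)
        then show "p \<in> primes_le z" using n by (simp add: primes_le_def)
      qed
      ultimately show "prime_factors n \<in> prime_sets z" by (simp add: prime_sets_def)
    qed
  qed auto
  also have "\<dots> \<le> (\<Sum>A\<in>prime_sets z. \<Prod>p\<in>A. 1 / (real p - 1))"
    by (intro sum_mono sum_inverse_same_prime_factors_le) (auto dest: prime_setsD(1,2))
  finally show ?thesis .
qed

text \<open>
  Every admissible set splits into a part avoiding \<open>Q\<close>, again admissible, and an arbitrary subset of
  \<open>Q\<close>; so the restriction to sets avoiding \<open>Q\<close> costs at most the Euler product over \<open>Q\<close>.
\<close>

lemma sum_prime_sets_avoid:
  fixes u :: "nat \<Rightarrow> real"
  assumes Q: "finite Q" and u: "\<And>p. prime p \<Longrightarrow> u p \<ge> 0" "\<And>p. p \<in> Q \<Longrightarrow> prime p"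
  shows "(\<Sum>A\<in>prime_sets z. prod u A) \<le> (\<Sum>A | A \<in> prime_sets z \<and> A \<inter> Q = {}. prod u A) * (\<Prod>p\<in>Q. 1 + u p)"
proof -
  define E where "E = {A \<in> prime_sets z. A \<inter> Q = {}}"
  have "(\<Sum>A\<in>prime_sets z. prod u A) = (\<Sum>A\<in>prime_sets z. prod u (A - Q) * prod u (A \<inter> Q))"
  proof (intro sum.cong refl)
    fix A assume "A \<in> prime_sets z"
    then have "finite A" by (rule prime_setsD)
    then show "prod u A = prod u (A - Q) * prod u (A \<inter> Q)"
      using prod.subset_diff[of "A \<inter> Q" A u] by (simp add: Diff_Int)
  qed
  also have "\<dots> = (\<Sum>(A, B)\<in>(\<lambda>A. (A - Q, A \<inter> Q)) ` prime_sets z. prod u A * prod u B)"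
    by (subst sum.reindex) (auto simp: inj_on_def)
  also have "\<dots> \<le> (\<Sum>(A, B)\<in>E \<times> Pow Q. prod u A * prod u B)"
  proof (rule sum_mono2)
    show "finite (E \<times> Pow Q)" using Q by (simp add: E_def)
    show "(\<lambda>A. (A - Q, A \<inter> Q)) ` prime_sets z \<subseteq> E \<times> Pow Q"
      by (auto simp: E_def intro: prime_sets_subset)
    fix AB assume AB: "AB \<in> E \<times> Pow Q - (\<lambda>A. (A - Q, A \<inter> Q)) ` prime_sets z"
    then obtain A B where AB: "AB = (A, B)" "A \<in> prime_sets z" "B \<subseteq> Q"
      by (auto simp: E_def)
    have "prod u A \<ge> 0" using u(1) prime_setsD(2)[OF AB(2)] by (intro prod_nonneg) blast
    moreover have "prod u B \<ge> 0" using u AB(3) by (intro prod_nonneg) blast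
    ultimately show "0 \<le> (case AB of (A, B) \<Rightarrow> prod u A * prod u B)"
      by (simp add: AB(1))
  qed
  also have "\<dots> = (\<Sum>A\<in>E. prod u A) * (\<Sum>B\<in>Pow Q. prod u B)"
    by (simp add: sum_product sum.cartesian_product)
  also have "(\<Sum>B\<in>Pow Q. prod u B) = (\<Prod>p\<in>Q. 1 + u p)"
    using prod_add[OF Q, of u "\<lambda>_. 1"] by (simp add: add.commute)
  finally show ?thesis unfolding E_def .
qed

text \<open>
  The term \<open>1 / (p / 2 - 1)\<close> belongs to a sieve with two classes modulo \<open>p\<close> and exceeds
  \<open>2 u + u\<^sup>2\<close> for \<open>u = 1 / (p - 1)\<close>. Hence the sum up to level \<open>z\<^sup>2\<close> is at least the square of the
  corresponding sum for one class up to level \<open>z\<close>, and the latter is compared with \<open>ln z\<close>.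
\<close>

lemma selberg_sum_lower:
  fixes Q :: "nat set"
  assumes Q: "finite Q" "\<And>p. p \<in> Q \<Longrightarrow> prime p" "2 \<in> Q"
  shows "(ln (real z + 1))\<^sup>2 / (\<Prod>p\<in>Q. real p / (real p - 1))\<^sup>2
    \<le> (\<Sum>A | A \<in> prime_sets (z\<^sup>2) \<and> A \<inter> Q = {}. \<Prod>p\<in>A. 1 / (real p / 2 - 1))"
proof -
  define u where "u = (\<lambda>p. 1 / (real p - 1))"
  define E where "E = {A \<in> prime_sets z. A \<inter> Q = {}}"
  define D where "D = {A \<in> prime_sets (z\<^sup>2). A \<inter> Q = {}}"
  define W where "W = (\<Prod>p\<in>Q. real p / (real p - 1))"
  have W: "W = (\<Prod>p\<in>Q. 1 + u p)"
    unfolding W_def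
  proof (intro prod.cong refl)
    fix p assume "p \<in> Q"
    then have "real p > 1" using Q(2) prime_gt_1_nat by auto
    then show "real p / (real p - 1) = 1 + u p" by (simp add: u_def field_simps)
  qed
  have W_pos: "W > 0"
    unfolding W_def using Q(2) 
  proof (intro prod_pos)
    fix p assume "p \<in> Q"
    then have "real p > 1" using Q(2) prime_gt_1_nat by auto
    then show "0 < real p / (real p - 1)" by simp
  qed
  have u_nonneg: "u p \<ge> 0" if "prime p" for p
    using prime_ge_1_nat[OF that] by (simp add: u_def)
  have "ln (real z + 1) \<le> (\<Sum>A\<in>E. prod u A) * W"
    using ln_le_sum_prime_sets[of z] sum_prime_sets_avoid[OF Q(1) u_nonneg Q(2)] unfolding E_def W u_def
    by (meson order_trans)
  then have "ln (real z + 1) / W \<le> (\<Sum>A\<in>E. prod u A)"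
    using W_pos by (simp add: field_simps)
  then have "(ln (real z + 1) / W)\<^sup>2 \<le> (\<Sum>A\<in>E. prod u A)\<^sup>2"
    using W_pos by (intro power_mono) auto
  also have "\<dots> \<le> (\<Sum>A\<in>D. \<Prod>p\<in>A. 2 * u p + (u p)\<^sup>2)"
  proof (rule sum_prod_squared_le)
    fix A B assume "A \<in> E" "B \<in> E"
    then have A: "A \<in> prime_sets z" "A \<inter> Q = {}" and B: "B \<in> prime_sets z" "B \<inter> Q = {}"
      by (auto simp: E_def)
    have "\<Prod>(A \<union> B) * \<Prod>(A \<inter> B) = \<Prod>A * \<Prod>B"
      using A B by (intro prod.union_inter) (auto dest: prime_setsD(1))
    moreover have "\<Prod>(A \<inter> B) \<ge> 1"
      using prime_setsD(2)[OF A(1)] by (intro prod_ge_1) (auto simp: Suc_le_eq prime_gt_0_nat)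
    ultimately have "\<Prod>(A \<union> B) \<le> \<Prod>A * \<Prod>B"
      by (metis mult.right_neutral mult_le_mono2)
    also have "\<dots> \<le> z * z"
      using A B by (intro mult_mono) (auto dest: prime_setsD(3))
    finally have "\<Prod>(A \<union> B) \<le> z\<^sup>2" by (simp add: power2_eq_square)
    moreover have "primes_le z \<subseteq> primes_le (z\<^sup>2)"
      by (auto simp: primes_le_def power2_eq_square intro: le_trans[OF _ le_square])
    then have "A \<union> B \<subseteq> primes_le (z\<^sup>2)"
      using A B by (auto simp: prime_sets_def)
    ultimately show "A \<union> B \<in> D" using A B by (auto simp: D_def prime_sets_def)
  next
    show "finite E" "finite D" by (simp_all add: E_def D_def)
    fix C assume "C \<in> D"
    then have C: "C \<in> prime_sets (z\<^sup>2)" by (simp add: D_def)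
    show "finite C" using C by (rule prime_setsD)
    show "u p \<ge> 0" if "p \<in> C" for p using prime_setsD(2)[OF C that] by (rule u_nonneg)
  qed
  also have "\<dots> \<le> (\<Sum>A\<in>D. \<Prod>p\<in>A. 1 / (real p / 2 - 1))"
  proof (intro sum_mono prod_mono conjI)
    fix A p assume A: "A \<in> D" "p \<in> A"
    then have p: "prime p" "p \<noteq> 2" using Q(3) prime_setsD(2)[of A "z\<^sup>2" p] by (auto simp: D_def)
    then have "p \<ge> 3" using prime_ge_2_nat[OF p(1)] by simp
    then have p3: "real p - 1 \<ge> 2" by simp
    show "0 \<le> 2 * u p + (u p)\<^sup>2" using u_nonneg[OF p(1)] by simp
    have *: "2 * (1 / t) + (1 / t)\<^sup>2 \<le> 1 / ((t - 1) / 2)" if "t \<ge> 2" for t :: real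
    proof -
      have "2 * (1 / t) + (1 / t)\<^sup>2 = (2 * t + 1) / t\<^sup>2"
        using that by (simp add: power2_eq_square add_divide_distrib)
      moreover have "(2 * t + 1) * (t - 1) \<le> 2 * t\<^sup>2"
        using that by (simp add: algebra_simps power2_eq_square)
      then have "(2 * t + 1) / t\<^sup>2 \<le> 2 / (t - 1)"
        using that by (subst pos_divide_le_eq) (simp_all add: pos_le_divide_eq)
      ultimately show ?thesis by simp
    qed
    have "(real p - 1 - 1) / 2 = real p / 2 - 1" by simp
    then show "2 * u p + (u p)\<^sup>2 \<le> 1 / (real p / 2 - 1)"
      using *[OF p3] unfolding u_def by metis
  qed
  finally show ?thesis by (simp add: D_def W_def power_divide)
qed

section \<open>Pairs of primes with a given difference\<close>

lemma prod_ge_2_power_card: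
  fixes A :: "nat set"
  assumes "\<And>p. p \<in> A \<Longrightarrow> prime p"
  shows "2 ^ card A \<le> \<Prod>A"
proof -
  have "(\<Prod>p\<in>A. 2) \<le> (\<Prod>p\<in>A. p)"
    using assms by (intro prod_mono) (auto simp: prime_ge_2_nat)
  then show ?thesis by simp
qed

lemma card_prime_sets_le: "card (prime_sets z) \<le> z"
proof -
  have "inj_on (\<lambda>A. \<Prod>A) (prime_sets z)"
    by (rule inj_on_subset[OF inj_on_prod_primes]) (auto dest: prime_setsD(1,2))
  moreover have "(\<lambda>A. \<Prod>A) ` prime_sets z \<subseteq> {1..z}"
  proof clarify
    fix A assume A: "A \<in> prime_sets z"
    have "\<Prod>A > 0"
      using prime_setsD(2)[OF A] by (intro prod_pos) (auto simp: prime_gt_0_nat)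
    then show "\<Prod>A \<in> {1..z}" using prime_setsD(3)[OF A] by simp
  qed
  ultimately have "card (prime_sets z) \<le> card {1..z}"
    by (intro card_inj_on_le) auto
  then show ?thesis by simp
qed

text \<open>
  For odd \<open>p\<close> the local weight \<open>p / (p - 2)\<close> is at most \<open>p\<close>, so every product of weights is at most \<open>z\<close>,
  and so is \<open>2 ^ card A\<close>. This trivial bound suffices because \<open>z\<close> will be a small power of the length of the sieved
  interval.
\<close>

lemma selberg_error_le:
  assumes D: "D \<subseteq> prime_sets z" "\<And>A. A \<in> D \<Longrightarrow> 2 \<notin> A"
  shows "(\<Sum>A\<in>D. \<Sum>B\<in>D. (\<Prod>p\<in>A. real p / 2 / (real p / 2 - 1)) * (\<Prod>p\<in>B. real p / 2 / (real p / 2 - 1))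
      * 2 ^ card (A \<union> B)) \<le> real z ^ 6"
proof -
  have finD: "finite D" using D(1) by (rule finite_subset) simp
  have weight: "0 \<le> (\<Prod>p\<in>A. real p / 2 / (real p / 2 - 1)) \<and> (\<Prod>p\<in>A. real p / 2 / (real p / 2 - 1)) \<le> real z"
    if A: "A \<in> D" for A
  proof -
    have sm: "A \<in> prime_sets z" using A D(1) by blast
    have p3: "real p \<ge> 3" if "p \<in> A" for p
    proof -
      have "p \<ge> 2" using prime_setsD(2)[OF sm that] by (rule prime_ge_2_nat)
      moreover have "p \<noteq> 2" using D(2)[OF A] that by blast
      ultimately show ?thesis by simp
    qed
    have "0 \<le> real p / 2 / (real p / 2 - 1)" "real p / 2 / (real p / 2 - 1) \<le> real p" if "p \<in> A" for p
    proof -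
      have "real p / 2 - 1 > 0" using p3[OF that] by simp
      then show "0 \<le> real p / 2 / (real p / 2 - 1)" by simp
      have "real p * 1 \<le> real p * (real p - 2)"
        using p3[OF that] by (intro mult_left_mono) auto
      then have "real p / 2 \<le> real p * (real p / 2 - 1)"
        by (simp add: algebra_simps)
      then show "real p / 2 / (real p / 2 - 1) \<le> real p"
        using \<open>real p / 2 - 1 > 0\<close> by (simp add: pos_divide_le_eq)
    qed
    then have "0 \<le> (\<Prod>p\<in>A. real p / 2 / (real p / 2 - 1))" "(\<Prod>p\<in>A. real p / 2 / (real p / 2 - 1)) \<le> (\<Prod>p\<in>A. real p)"
      by (auto intro!: prod_nonneg prod_mono)
    moreover have "(\<Prod>p\<in>A. real p) \<le> real z"
      using of_nat_mono[OF prime_setsD(3)[OF sm], where ?'a = real] by (simp add: of_nat_prod)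
    ultimately show ?thesis by linarith
  qed
  have card2: "(2::real) ^ card (A \<union> B) \<le> real z * real z" if "A \<in> D" "B \<in> D" for A B
  proof -
    have sm: "A \<in> prime_sets z" "B \<in> prime_sets z" using that D(1) by blast+
    have "2 ^ card A \<le> z" "2 ^ card B \<le> z"
      using order_trans[OF prod_ge_2_power_card[OF prime_setsD(2)[OF sm(1)]] prime_setsD(3)[OF sm(1)]]
        order_trans[OF prod_ge_2_power_card[OF prime_setsD(2)[OF sm(2)]] prime_setsD(3)[OF sm(2)]] by auto
    then have "2 ^ card A * 2 ^ card B \<le> z * z" by (rule mult_mono) auto
    moreover have "(2::nat) ^ card (A \<union> B) \<le> 2 ^ (card A + card B)"
      by (intro power_increasing card_Un_le) auto
    ultimately have "(2::nat) ^ card (A \<union> B) \<le> z * z" by (simp add: power_add)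
    from of_nat_mono[OF this, where ?'a = real] show ?thesis by simp
  qed
  have "(\<Sum>A\<in>D. \<Sum>B\<in>D. (\<Prod>p\<in>A. real p / 2 / (real p / 2 - 1)) * (\<Prod>p\<in>B. real p / 2 / (real p / 2 - 1))
      * 2 ^ card (A \<union> B)) \<le> (\<Sum>A\<in>D. \<Sum>B\<in>D. real z * real z * (real z * real z))"
    using weight card2 by (intro sum_mono mult_mono mult_nonneg_nonneg) auto
  also have "\<dots> = real (card D) * real (card D) * real z ^ 4"
    by (simp add: power4_eq_xxxx mult_ac)
  also have "\<dots> \<le> real z * real z * real z ^ 4"
  proof -
    have "card D \<le> card (prime_sets z)" using D(1) by (intro card_mono) auto
    then have "real (card D) \<le> real z" using card_prime_sets_le[of z] by linarith
    then show ?thesis by (intro mult_mono) auto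
  qed
  also have "\<dots> = real z ^ 6" by (simp add: power_numeral_reduce)
  finally show ?thesis .
qed

text \<open>
  Primes \<open>n\<close> and \<open>n + d\<close> with \<open>n > z\<^sup>2\<close> survive the sieve by all odd primes up to \<open>z\<^sup>2\<close> that do not
  divide \<open>d\<close>. Leaving out the divisors of \<open>d\<close> keeps the local densities uniform, at the price of
  the Euler product in the bound.
\<close>

lemma card_prime_pairs_le:
  assumes d: "d \<ge> 1" and z: "z \<ge> 1"
  shows "real (card {n. n < N \<and> prime n \<and> prime (n + d)})
    \<le> real N * (\<Prod>p\<in>prime_factors (2 * d). real p / (real p - 1))\<^sup>2 / (ln (real z + 1))\<^sup>2
      + (real z ^ 2 + real z ^ 12)"
proof -
  define Q where "Q = prime_factors (2 * d)"
  define P where "P = primes_le (z\<^sup>2) - Q"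
  define D where "D = {A \<in> prime_sets (z\<^sup>2). A \<inter> Q = {}}"
  define W where "W = (\<Prod>p\<in>Q. real p / (real p - 1))"
  define hit where "hit = (\<lambda>n. {p. p dvd n * (n + d)})"
  define G where "G = (\<Sum>A\<in>D. \<Prod>p\<in>A. 1 / (real p / 2 - 1))"
  have Q2: "2 \<in> Q" using d by (simp add: Q_def in_prime_factors_iff)
  have Qd: "p \<in> Q" if "prime p" "p dvd d" for p
    using that d by (simp add: Q_def in_prime_factors_iff)
  have p3: "real p / 2 > 1" if "p \<in> P" for p
  proof -
    have "prime p" "p \<noteq> 2" using that Q2 by (auto simp: P_def primes_le_def)
    then have "p > 2" using prime_ge_2_nat[of p] by linarith
    then show ?thesis by simp
  qed
  have local: "\<bar>real (card {n \<in> {..<N}. A \<subseteq> hit n}) - real N / (\<Prod>p\<in>A. real p / 2)\<bar> \<le> 2 ^ card A"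
    if A: "A \<subseteq> P" for A
  proof -
    have "{n \<in> {..<N}. A \<subseteq> hit n} = {n. n < N \<and> (\<forall>p\<in>A. p dvd n * (n + d))}"
      by (auto simp: hit_def)
    moreover have "finite A" using A by (rule finite_subset) (simp add: P_def)
    moreover have "prime p" "\<not> p dvd d" if "p \<in> A" for p
      using that A Qd by (auto simp: P_def primes_le_def)
    ultimately show ?thesis using card_local_shifted_product[of A d N] by simp
  qed
  have "real (card {n \<in> {..<N}. hit n \<inter> P = {}}) \<le> real N / (\<Sum>A\<in>D. \<Prod>p\<in>A. 1 / (real p / 2 - 1))
    + (\<Sum>A\<in>D. \<Sum>B\<in>D. (\<Prod>p\<in>A. real p / 2 / (real p / 2 - 1)) * (\<Prod>p\<in>B. real p / 2 / (real p / 2 - 1)) * 2 ^ card (A \<union> B))"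
  proof (rule selberg_sieve)
    show "finite P" "finite {..<N}" by (simp_all add: P_def)
    show "D \<subseteq> Pow P" by (auto simp: D_def P_def prime_sets_def)
    show "B \<in> D" if "A \<in> D" "B \<subseteq> A" for A B
      using that prime_sets_subset[of A "z\<^sup>2" B] by (auto simp: D_def)
    show "{} \<in> D" using z by (simp add: D_def prime_sets_def)
  qed (use p3 local in auto)
  also have "(\<Sum>A\<in>D. \<Sum>B\<in>D. (\<Prod>p\<in>A. real p / 2 / (real p / 2 - 1)) * (\<Prod>p\<in>B. real p / 2 / (real p / 2 - 1)) * 2 ^ card (A \<union> B))
      \<le> real (z\<^sup>2) ^ 6"
    using Q2 by (intro selberg_error_le) (auto simp: D_def)
  also have "real N / (\<Sum>A\<in>D. \<Prod>p\<in>A. 1 / (real p / 2 - 1)) \<le> real N / ((ln (real z + 1))\<^sup>2 / W\<^sup>2)"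
  proof (rule divide_left_mono)
    show "(ln (real z + 1))\<^sup>2 / W\<^sup>2 \<le> (\<Sum>A\<in>D. \<Prod>p\<in>A. 1 / (real p / 2 - 1))"
      unfolding W_def D_def using Q2 by (intro selberg_sum_lower) (auto simp: Q_def)
    moreover have "W > 0" unfolding W_def
    proof (rule prod_pos)
      fix p assume "p \<in> Q"
      then have "prime p" by (simp add: Q_def in_prime_factors_iff)
      then have "real p > 1" using prime_gt_1_nat by simp
      then show "0 < real p / (real p - 1)" by simp
    qed
    then have "0 < (ln (real z + 1))\<^sup>2 / W\<^sup>2" using z by simp
    ultimately show "0 < (\<Sum>A\<in>D. \<Prod>p\<in>A. 1 / (real p / 2 - 1)) * ((ln (real z + 1))\<^sup>2 / W\<^sup>2)"
      by (intro mult_pos_pos) linarith+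
  qed simp
  finally have sieve: "real (card {n \<in> {..<N}. hit n \<inter> P = {}})
    \<le> real N * W\<^sup>2 / (ln (real z + 1))\<^sup>2 + real z ^ 12"
    by (simp add: power_mult[symmetric])
  have "{n. n < N \<and> prime n \<and> prime (n + d)} \<subseteq> {1..z\<^sup>2} \<union> {n \<in> {..<N}. hit n \<inter> P = {}}"
  proof
    fix n assume "n \<in> {n. n < N \<and> prime n \<and> prime (n + d)}"
    then have n: "n < N" "prime n" "prime (n + d)" by auto
    show "n \<in> {1..z\<^sup>2} \<union> {n \<in> {..<N}. hit n \<inter> P = {}}"
    proof (cases "hit n \<inter> P = {}")
      case False
      then obtain p where p: "p \<in> P" "p dvd n * (n + d)" by (auto simp: hit_def)
      have "prime p" using p(1) by (simp add: P_def primes_le_def)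
      then have "p dvd n \<or> p dvd n + d" using p(2) by (simp add: prime_dvd_mult_iff)
      then have "p = n \<or> p = n + d" using \<open>prime p\<close> n(2,3) primes_dvd_imp_eq by blast
      then have "n \<le> z\<^sup>2" using p(1) by (auto simp: P_def primes_le_def)
      then show ?thesis using prime_ge_1_nat[OF n(2)] by simp
    qed (use n in simp)
  qed
  then have "card {n. n < N \<and> prime n \<and> prime (n + d)} \<le> card ({1..z\<^sup>2} \<union> {n \<in> {..<N}. hit n \<inter> P = {}})"
    by (intro card_mono) auto
  also have "\<dots> \<le> z\<^sup>2 + card {n \<in> {..<N}. hit n \<inter> P = {}}"
    using card_Un_le[of "{1..z\<^sup>2}"] by simp
  finally have "real (card {n. n < N \<and> prime n \<and> prime (n + d)}) \<le> real (z\<^sup>2) + real (card {n \<in> {..<N}. hit n \<inter> P = {}})"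
    unfolding of_nat_add[symmetric] of_nat_le_iff .
  then show ?thesis using sieve by (simp add: W_def Q_def)
qed

section \<open>The singular factor on average over the difference\<close>

lemma card_multiples_le:
  fixes m h :: nat
  assumes "m > 0"
  shows "real (card {d \<in> {1..h}. m dvd d}) \<le> real h / real m"
proof -
  have "{d \<in> {1..h}. m dvd d} \<subseteq> (\<lambda>k. m * k) ` {1..h div m}"
  proof clarify
    fix d assume d: "d \<in> {1..h}" "m dvd d"
    then have "d = m * (d div m)" "d div m \<le> h div m" "d div m > 0"
      using assms by (auto intro: div_le_mono simp: div_greater_zero_iff dvd_imp_le)
    then show "d \<in> (\<lambda>k. m * k) ` {1..h div m}"
      by (intro image_eqI[of _ _ "d div m"]) auto
  qed
  then have "card {d \<in> {1..h}. m dvd d} \<le> card ((\<lambda>k. m * k) ` {1..h div m})"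
    by (intro card_mono) auto
  also have "\<dots> \<le> h div m"
    using card_image_le[of "{1..h div m}" "\<lambda>k. m * k"] by simp
  finally have "real (card {d \<in> {1..h}. m dvd d}) \<le> real (h div m)" by simp
  also have "\<dots> \<le> real h / real m" by (rule of_nat_div_le_of_nat)
  finally show ?thesis .
qed

lemma sum_inverse_squares_le: "h \<ge> 1 \<Longrightarrow> (\<Sum>n=2..h. 1 / (real n)\<^sup>2) \<le> 1 - 1 / real h"
proof (induction h rule: dec_induct)
  case (step h)
  have "1 / (real (Suc h))\<^sup>2 \<le> 1 / (real h * real (Suc h))"
    using step(1) by (intro divide_left_mono) (auto simp: power2_eq_square)
  also have "\<dots> = 1 / real h - 1 / real (Suc h)"
    using step(1) by (simp add: divide_simps)
  finally have "1 / (real (Suc h))\<^sup>2 \<le> 1 / real h - 1 / real (Suc h)" .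
  moreover have "(\<Sum>n=2..Suc h. 1 / (real n)\<^sup>2) = (\<Sum>n=2..h. 1 / (real n)\<^sup>2) + 1 / (real (Suc h))\<^sup>2"
    using step(1) by (subst sum.nat_ivl_Suc') auto
  ultimately show ?case using step(3) by linarith
qed simp

text \<open>
  Expanding the product over the sets \<open>A\<close> of prime factors of \<open>d\<close> and summing over \<open>d\<close> first, each \<open>A\<close>
  occurs for at most \<open>h / \<Prod>A\<close> values of \<open>d\<close>. This gains a second factor \<open>1 / p\<close> for each prime and
  leaves \<open>h\<close> times the convergent product of the \<open>1 + c / p\<^sup>2\<close>.
\<close>

lemma sum_prime_factor_products_le:
  fixes c :: real
  assumes c: "c \<ge> 0"
  shows "(\<Sum>d=1..h. \<Prod>p\<in>prime_factors d. 1 + c / real p) \<le> real h * exp c"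
proof (cases "h \<ge> 1")
  case True
  define u where "u = (\<lambda>p. c / real p)"
  have sub: "prime_factors d \<subseteq> primes_le h" if "d \<in> {1..h}" for d
  proof
    fix p assume "p \<in> prime_factors d"
    then have "prime p" "p \<le> d" using that by (auto simp: in_prime_factors_iff intro: dvd_imp_le)
    then show "p \<in> primes_le h" using that by (simp add: primes_le_def)
  qed
  have "(\<Sum>d=1..h. \<Prod>p\<in>prime_factors d. 1 + c / real p) = (\<Sum>d=1..h. \<Sum>A | A \<in> Pow (primes_le h) \<and> A \<subseteq> prime_factors d. prod u A)"
  proof (intro sum.cong refl)
    fix d assume d: "d \<in> {1..h}"
    have "(\<Prod>p\<in>prime_factors d. 1 + c / real p) = (\<Prod>p\<in>prime_factors d. u p + 1)"
      by (simp add: u_def add.commute)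
    also have "\<dots> = (\<Sum>A\<in>Pow (prime_factors d). prod u A)"
      by (subst prod_add) auto
    also have "Pow (prime_factors d) = {A \<in> Pow (primes_le h). A \<subseteq> prime_factors d}"
      using sub[OF d] by auto
    finally show "(\<Prod>p\<in>prime_factors d. 1 + c / real p) = (\<Sum>A | A \<in> Pow (primes_le h) \<and> A \<subseteq> prime_factors d. prod u A)" .
  qed
  also have "\<dots> = (\<Sum>A\<in>Pow (primes_le h). \<Sum>d | d \<in> {1..h} \<and> A \<subseteq> prime_factors d. prod u A)"
    by (rule sum.swap_restrict) auto
  also have "\<dots> \<le> (\<Sum>A\<in>Pow (primes_le h). real h * (\<Prod>p\<in>A. c / (real p)\<^sup>2))"
  proof (rule sum_mono)
    fix A assume A: "A \<in> Pow (primes_le h)"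
    then have fin: "finite A" using finite_subset by auto
    have prime: "prime p" if "p \<in> A" for p using that A by (auto simp: primes_le_def)
    have pos: "\<Prod>A > 0" using prime by (intro prod_pos) (auto simp: prime_gt_0_nat)
    have nonneg: "prod u A \<ge> 0" using c by (intro prod_nonneg) (auto simp: u_def)
    have "card {d \<in> {1..h}. A \<subseteq> prime_factors d} \<le> card {d \<in> {1..h}. \<Prod>A dvd d}"
    proof (rule card_mono)
      show "{d \<in> {1..h}. A \<subseteq> prime_factors d} \<subseteq> {d \<in> {1..h}. \<Prod>A dvd d}"
        using prod_primes_dvdI[OF fin prime] by (auto simp: subset_iff in_prime_factors_iff)
    qed simp
    then have "real (card {d \<in> {1..h}. A \<subseteq> prime_factors d}) \<le> real (card {d \<in> {1..h}. \<Prod>A dvd d})"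
      by simp
    also have "\<dots> \<le> real h / real (\<Prod>A)"
      using pos by (rule card_multiples_le)
    finally have "real (card {d \<in> {1..h}. A \<subseteq> prime_factors d}) * prod u A \<le> real h / real (\<Prod>A) * prod u A"
      using nonneg by (rule mult_right_mono)
    also have "\<dots> = real h * (\<Prod>p\<in>A. c / (real p)\<^sup>2)"
      by (simp add: u_def prod_dividef power2_eq_square prod.distrib)
    finally show "(\<Sum>d | d \<in> {1..h} \<and> A \<subseteq> prime_factors d. prod u A) \<le> real h * (\<Prod>p\<in>A. c / (real p)\<^sup>2)"
      by simp
  qed
  also have "\<dots> = real h * (\<Prod>p\<in>primes_le h. c / (real p)\<^sup>2 + 1)"
    by (subst prod_add) (auto simp: sum_distrib_left)
  also have "(\<Prod>p\<in>primes_le h. c / (real p)\<^sup>2 + 1) \<le> (\<Prod>p\<in>primes_le h. exp (c / (real p)\<^sup>2))"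
    using c exp_ge_add_one_self by (intro prod_mono) (auto simp: add.commute intro!: add_nonneg_nonneg)
  also have "\<dots> = exp (c * (\<Sum>p\<in>primes_le h. 1 / (real p)\<^sup>2))"
    by (simp add: exp_sum[symmetric] sum_distrib_left)
  also have "\<dots> \<le> exp (c * 1)"
  proof -
    have "(\<Sum>p\<in>primes_le h. 1 / (real p)\<^sup>2) \<le> (\<Sum>n=2..h. 1 / (real n)\<^sup>2)"
      by (rule sum_mono2) (auto simp: primes_le_def prime_ge_2_nat)
    also have "\<dots> \<le> 1 - 1 / real h" using True by (rule sum_inverse_squares_le)
    also have "\<dots> \<le> 1" by simp
    finally show ?thesis using c by (simp only: exp_le_cancel_iff) (rule mult_left_mono)
  qed
  finally show ?thesis by (simp add: mult_left_mono)
qed simp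

text \<open>
  The factor 4 accounts for the prime 2 when \<open>d\<close> is odd. For the divisors of \<open>d\<close> the bound rests on the inequality
  \<open>(p / (p - 1))\<^sup>2 \<le> 1 + 6 / p\<close>, where the difference of the two sides has the sign of
  \<open>(4 p - 3) (p - 2)\<close>.
\<close>

lemma singular_factor_le:
  assumes "d \<ge> 1"
  shows "(\<Prod>p\<in>prime_factors (2 * d). real p / (real p - 1))\<^sup>2 \<le> 4 * (\<Prod>p\<in>prime_factors d. 1 + 6 / real p)"
proof -
  define g where "g = (\<lambda>p. (real p / (real p - 1))\<^sup>2)"
  have g: "0 \<le> g p" "g p \<le> 1 + 6 / real p" if "prime p" for p
  proof -
    define x where "x = real p"
    have x: "x \<ge> 2" using prime_ge_2_nat[OF that] by (simp add: x_def)
    have "0 \<le> (4 * x - 3) * (x - 2)" using x by simp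
    then have "x\<^sup>2 * x \<le> (x + 6) * (x - 1)\<^sup>2"
      by (simp add: algebra_simps power2_eq_square)
    then have "x\<^sup>2 / (x - 1)\<^sup>2 \<le> (x + 6) / x"
      using x by (simp add: pos_divide_le_eq pos_le_divide_eq)
    also have "\<dots> = 1 + 6 / x" using x by (simp add: add_divide_distrib)
    finally show "g p \<le> 1 + 6 / real p" by (simp add: g_def x_def power_divide)
  qed (simp add: g_def)
  have pf: "prime_factors (2 * d) = insert 2 (prime_factors d)"
    using assms primes_dvd_imp_eq[of _ "2::nat"] by (auto simp: in_prime_factors_iff prime_dvd_mult_iff)
  have "(\<Prod>p\<in>prime_factors (2 * d). real p / (real p - 1))\<^sup>2 = prod g (insert 2 (prime_factors d))"
    unfolding pf g_def by (rule prod_power_distrib)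
  also have "\<dots> \<le> 4 * prod g (prime_factors d)"
  proof -
    have "prod g (prime_factors d) \<ge> 0" using g(1) by (intro prod_nonneg) auto
    then show ?thesis by (cases "2 \<in> prime_factors d") (auto simp: insert_absorb, simp_all add: g_def)
  qed
  also have "\<dots> \<le> 4 * (\<Prod>p\<in>prime_factors d. 1 + 6 / real p)"
    using g by (intro mult_left_mono prod_mono) auto
  finally show ?thesis .
qed

text \<open>
  When \<open>z\<close> is a small power of \<open>N\<close>, the right side is of order \<open>N h / (ln N)\<^sup>2\<close>: on average over \<open>d\<close>,
  there are at most a constant times as many pairs as for a random set of density \<open>1 / ln N\<close>.
\<close>

lemma sum_card_prime_pairs_le:
  assumes z: "z \<ge> 1"
  shows "(\<Sum>d=1..h. real (card {n. n < N \<and> prime n \<and> prime (n + d)}))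
    \<le> 4 * exp 6 * real N * real h / (ln (real z + 1))\<^sup>2 + real h * (real z ^ 2 + real z ^ 12)"
proof -
  define c where "c = real N / (ln (real z + 1))\<^sup>2"
  have c: "c \<ge> 0" by (simp add: c_def)
  have "(\<Sum>d=1..h. real (card {n. n < N \<and> prime n \<and> prime (n + d)}))
    \<le> (\<Sum>d=1..h. c * (4 * (\<Prod>p\<in>prime_factors d. 1 + 6 / real p)) + (real z ^ 2 + real z ^ 12))"
  proof (rule sum_mono)
    fix d assume d: "d \<in> {1..h}"
    have "real (card {n. n < N \<and> prime n \<and> prime (n + d)})
      \<le> c * (\<Prod>p\<in>prime_factors (2 * d). real p / (real p - 1))\<^sup>2 + (real z ^ 2 + real z ^ 12)"
      using card_prime_pairs_le[of d z N] d z by (simp add: c_def)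
    also have "c * (\<Prod>p\<in>prime_factors (2 * d). real p / (real p - 1))\<^sup>2 \<le> c * (4 * (\<Prod>p\<in>prime_factors d. 1 + 6 / real p))"
      using d c by (intro mult_left_mono singular_factor_le) auto
    finally show "real (card {n. n < N \<and> prime n \<and> prime (n + d)})
      \<le> c * (4 * (\<Prod>p\<in>prime_factors d. 1 + 6 / real p)) + (real z ^ 2 + real z ^ 12)" by simp
  qed
  also have "\<dots> = 4 * c * (\<Sum>d=1..h. \<Prod>p\<in>prime_factors d. 1 + 6 / real p) + real h * (real z ^ 2 + real z ^ 12)"
    by (simp add: sum.distrib sum_distrib_left mult_ac)
  also have "4 * c * (\<Sum>d=1..h. \<Prod>p\<in>prime_factors d. 1 + 6 / real p) \<le> 4 * c * (real h * exp 6)"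
    using c by (intro mult_left_mono sum_prime_factor_products_le) auto
  finally show ?thesis by (simp add: c_def mult_ac)
qed

section \<open>Counting distinct quotients\<close>

text \<open>
  Cauchy-Schwarz for the sizes of the fibres of \<open>g\<close>: few values force many collisions.
\<close>

lemma card_squared_le_collisions:
  assumes Q: "finite Q"
  shows "(card Q)\<^sup>2 \<le> card (g ` Q) * card {(p, q) \<in> Q \<times> Q. g p = g q}"
proof -
  define m where "m = (\<lambda>v. card {p \<in> Q. g p = v})"
  have "card Q = (\<Sum>v\<in>g ` Q. m v)"
    unfolding m_def using sum.group[of Q "g ` Q" g "\<lambda>_. 1::nat"] Q by simp
  moreover have "card {(p, q) \<in> Q \<times> Q. g p = g q} = (\<Sum>v\<in>g ` Q. (m v)\<^sup>2)"
  proof -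
    have "{(p, q) \<in> Q \<times> Q. g p = g q} = (\<Union>v\<in>g ` Q. {p \<in> Q. g p = v} \<times> {p \<in> Q. g p = v})"
      by auto
    also have "card \<dots> = (\<Sum>v\<in>g ` Q. card ({p \<in> Q. g p = v} \<times> {p \<in> Q. g p = v}))"
      using Q by (intro card_UN_disjoint) auto
    finally show ?thesis by (simp add: m_def card_cartesian_product power2_eq_square)
  qed
  moreover have "(\<Sum>v\<in>g ` Q. real (m v) * 1)\<^sup>2 \<le> (\<Sum>v\<in>g ` Q. (real (m v))\<^sup>2) * (\<Sum>v\<in>g ` Q. 1\<^sup>2)"
    by (rule Cauchy_Schwarz_ineq_sum)
  ultimately have "real ((card Q)\<^sup>2) \<le> real (card (g ` Q) * card {(p, q) \<in> Q \<times> Q. g p = g q})"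
    by (simp add: mult.commute)
  then show ?thesis by linarith
qed

lemma same_quotient_imp_close:
  fixes X Y p q h :: nat
  assumes "\<lfloor>real X / real p\<rfloor> = \<lfloor>real X / real q\<rfloor>" "0 < p" "p < q" "q \<le> Y" "Y\<^sup>2 \<le> h * X"
  shows "q - p \<le> h"
proof -
  have X: "X > 0"
  proof (rule ccontr)
    assume "\<not> X > 0"
    then have "Y = 0" using assms(5) by simp
    then show False using assms by simp
  qed
  have "real X / real p - real X / real q < 1"
    using assms(1) by linarith
  then have "real X * (real q - real p) < real p * real q"
    using assms(2,3) by (simp add: field_simps)
  also have "\<dots> \<le> real Y * real Y"
    using assms by (intro mult_mono) auto
  also have "\<dots> \<le> real h * real X"
    using of_nat_mono[OF assms(5), where ?'a = real] by (simp add: power2_eq_square)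
  finally have "real X * (real q - real p) < real X * real h"
    by (simp add: mult.commute)
  then show ?thesis using X assms(3) by (simp add: of_nat_diff[symmetric] del: of_nat_diff)
qed

text \<open>
  The diagonal contributes \<open>\<pi>(Y)\<close>; every other collision is, in one of the two orders, a pair of
  primes whose difference is at most \<open>h\<close>.
\<close>

lemma card_collisions_le:
  assumes "Y\<^sup>2 \<le> h * X"
  shows "card {(p, q) \<in> primes_le Y \<times> primes_le Y. \<lfloor>real X / real p\<rfloor> = \<lfloor>real X / real q\<rfloor>}
    \<le> card (primes_le Y) + 2 * (\<Sum>d=1..h. card {n. n < Y + 1 \<and> prime n \<and> prime (n + d)})"
proof -
  define I where "I = (SIGMA d:{1..h}. {n. n < Y + 1 \<and> prime n \<and> prime (n + d)})"
  have finI: "finite I" by (simp add: I_def)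
  have cardI: "card I = (\<Sum>d=1..h. card {n. n < Y + 1 \<and> prime n \<and> prime (n + d)})"
    unfolding I_def by (rule card_SigmaI) auto
  have mem: "(q - p, p) \<in> I" if "p \<in> primes_le Y" "q \<in> primes_le Y" "p < q"
    "\<lfloor>real X / real p\<rfloor> = \<lfloor>real X / real q\<rfloor>" for p q
    using same_quotient_imp_close[OF that(4) _ that(3) _ assms] that
    by (auto simp: I_def primes_le_def prime_gt_0_nat)
  have "{(p, q) \<in> primes_le Y \<times> primes_le Y. \<lfloor>real X / real p\<rfloor> = \<lfloor>real X / real q\<rfloor>}
    \<subseteq> (\<lambda>p. (p, p)) ` primes_le Y \<union> ((\<lambda>(d, n). (n, n + d)) ` I \<union> (\<lambda>(d, n). (n + d, n)) ` I)"
  proof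
    fix pq assume "pq \<in> {(p, q) \<in> primes_le Y \<times> primes_le Y. \<lfloor>real X / real p\<rfloor> = \<lfloor>real X / real q\<rfloor>}"
    then obtain p q where pq: "pq = (p, q)" "p \<in> primes_le Y" "q \<in> primes_le Y"
      "\<lfloor>real X / real p\<rfloor> = \<lfloor>real X / real q\<rfloor>" by auto
    consider "p = q" | "p < q" | "q < p" by linarith
    then show "pq \<in> (\<lambda>p. (p, p)) ` primes_le Y \<union> ((\<lambda>(d, n). (n, n + d)) ` I \<union> (\<lambda>(d, n). (n + d, n)) ` I)"
    proof cases
      case 2
      then have "(q - p, p) \<in> I" using pq by (intro mem)
      then have "pq \<in> (\<lambda>(d, n). (n, n + d)) ` I"
        using 2 pq(1) by (intro image_eqI[of _ _ "(q - p, p)"]) auto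
      then show ?thesis by blast
    next
      case 3
      then have "(p - q, q) \<in> I" using pq by (intro mem) auto
      then have "pq \<in> (\<lambda>(d, n). (n + d, n)) ` I"
        using 3 pq(1) by (intro image_eqI[of _ _ "(p - q, q)"]) auto
      then show ?thesis by blast
    qed (use pq in auto)
  qed
  then have "card {(p, q) \<in> primes_le Y \<times> primes_le Y. \<lfloor>real X / real p\<rfloor> = \<lfloor>real X / real q\<rfloor>}
    \<le> card ((\<lambda>p. (p, p)) ` primes_le Y \<union> ((\<lambda>(d, n). (n, n + d)) ` I \<union> (\<lambda>(d, n). (n + d, n)) ` I))"
    using finI by (intro card_mono) auto
  also have "\<dots> \<le> card ((\<lambda>p. (p, p)) ` primes_le Y) + (card ((\<lambda>(d, n). (n, n + d)) ` I) + card ((\<lambda>(d, n). (n + d, n)) ` I))"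
    by (meson add_left_mono card_Un_le order_trans)
  also have "\<dots> \<le> card (primes_le Y) + (card I + card I)"
    using finI by (intro add_mono card_image_le) auto
  finally show ?thesis using cardI by simp
qed

lemma S_p_eq_image: "S_p X = (\<lambda>p. \<lfloor>real X / real p\<rfloor>) ` primes_le X"
  by (auto simp: S_p_def primes_le_def)

lemma finite_S_p: "finite (S_p X)"
  by (simp add: S_p_eq_image)

lemma card_S_p_lower:
  fixes X Y h z :: nat
  assumes "Y \<le> X" "Y\<^sup>2 \<le> h * X" "z \<ge> 1"
  shows "real (card (primes_le Y)) ^ 2 \<le> real (card (S_p X)) * (real (card (primes_le Y))
    + 2 * (4 * exp 6 * (real Y + 1) * real h / (ln (real z + 1))\<^sup>2 + real h * (real z ^ 2 + real z ^ 12)))"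
proof -
  define g where "g = (\<lambda>p::nat. \<lfloor>real X / real p\<rfloor>)"
  define C where "C = {(p, q) \<in> primes_le Y \<times> primes_le Y. g p = g q}"
  have "g ` primes_le Y \<subseteq> S_p X"
    using assms(1) unfolding S_p_eq_image g_def by (intro image_mono) (auto simp: primes_le_def)
  then have img: "card (g ` primes_le Y) \<le> card (S_p X)"
    by (intro card_mono finite_S_p)
  have "(card (primes_le Y))\<^sup>2 \<le> card (g ` primes_le Y) * card C"
    unfolding C_def by (intro card_squared_le_collisions) auto
  also have "\<dots> \<le> card (S_p X) * card C"
    using img by (rule mult_right_mono) simp
  finally have "real ((card (primes_le Y))\<^sup>2) \<le> real (card (S_p X) * card C)"
    by (rule of_nat_mono)
  then have 1: "real (card (primes_le Y)) ^ 2 \<le> real (card (S_p X)) * real (card C)"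
    by simp
  have "real (card C) \<le> real (card (primes_le Y) + 2 * (\<Sum>d=1..h. card {n. n < Y + 1 \<and> prime n \<and> prime (n + d)}))"
    unfolding C_def g_def by (intro of_nat_mono card_collisions_le assms)
  also have "\<dots> = real (card (primes_le Y)) + 2 * (\<Sum>d=1..h. real (card {n. n < Y + 1 \<and> prime n \<and> prime (n + d)}))"
    by simp
  also have "\<dots> \<le> real (card (primes_le Y))
    + 2 * (4 * exp 6 * real (Y + 1) * real h / (ln (real z + 1))\<^sup>2 + real h * (real z ^ 2 + real z ^ 12))"
    by (intro add_mono mult_left_mono sum_card_prime_pairs_le assms) auto
  finally have "real (card C) \<le> \<dots>" .
  then have "real (card (S_p X)) * real (card C) \<le> real (card (S_p X)) * (real (card (primes_le Y))
    + 2 * (4 * exp 6 * real (Y + 1) * real h / (ln (real z + 1))\<^sup>2 + real h * (real z ^ 2 + real z ^ 12)))"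
    by (intro mult_left_mono) auto
  with 1 show ?thesis by (simp add: add.commute)
qed

lemma card_S_p_upper:
  fixes X Y :: nat
  assumes "Y \<ge> 1"
  shows "real (card (S_p X)) \<le> real (card (primes_le Y)) + real X / real Y + 1"
proof -
  define g where "g = (\<lambda>p::nat. \<lfloor>real X / real p\<rfloor>)"
  have "S_p X \<subseteq> g ` primes_le Y \<union> {0..\<lfloor>real X / real Y\<rfloor>}"
  proof
    fix v assume "v \<in> S_p X"
    then obtain p where p: "prime p" "p \<le> X" "v = g p"
      by (auto simp: S_p_def g_def)
    show "v \<in> g ` primes_le Y \<union> {0..\<lfloor>real X / real Y\<rfloor>}"
    proof (cases "p \<le> Y")
      case False
      then have "real X / real p \<le> real X / real Y"
        using assms by (intro divide_left_mono) auto
      then have "v \<in> {0..\<lfloor>real X / real Y\<rfloor>}"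
        using p(3) by (auto simp: g_def intro: floor_mono)
      then show ?thesis by blast
    qed (use p in \<open>auto simp: primes_le_def\<close>)
  qed
  then have "card (S_p X) \<le> card (g ` primes_le Y \<union> {0..\<lfloor>real X / real Y\<rfloor>})"
    by (intro card_mono) auto
  also have "\<dots> \<le> card (g ` primes_le Y) + card {0..\<lfloor>real X / real Y\<rfloor>}"
    by (rule card_Un_le)
  also have "\<dots> \<le> card (primes_le Y) + nat (\<lfloor>real X / real Y\<rfloor> + 1)"
    by (intro add_mono card_image_le) auto
  finally have "real (card (S_p X)) \<le> real (card (primes_le Y)) + real (nat (\<lfloor>real X / real Y\<rfloor> + 1))"
    by linarith
  moreover have "real (nat (\<lfloor>real X / real Y\<rfloor> + 1)) \<le> real X / real Y + 1"
  proof -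
    have "\<lfloor>real X / real Y\<rfloor> \<ge> 0" by simp
    then show ?thesis by linarith
  qed
  ultimately show ?thesis by linarith
qed

text \<open>
  For positive functions, the finitely many exceptions to an asymptotic inequality can be absorbed into the
  constant.
\<close>

lemma eventually_le_imp_uniformly_le:
  fixes f g :: "nat \<Rightarrow> real"
  assumes pos: "\<And>n. n \<ge> m \<Longrightarrow> f n > 0" "\<And>n. n \<ge> m \<Longrightarrow> g n > 0"
    and ev: "eventually (\<lambda>n. f n \<le> C * g n) sequentially"
  obtains C' where "C' > 0" "\<And>n. n \<ge> m \<Longrightarrow> f n \<le> C' * g n"
proof -
  obtain N where N: "f n \<le> C * g n" if "n \<ge> N" for n
    using ev by (auto simp: eventually_sequentially)
  define R where "R = (\<Sum>n=m..N. f n / g n)"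
  have R: "R \<ge> 0" unfolding R_def using pos by (intro sum_nonneg divide_nonneg_nonneg) (auto intro: less_imp_le)
  show ?thesis
  proof
    show "\<bar>C\<bar> + 1 + R > 0" using R by simp
    fix n assume n: "n \<ge> m"
    show "f n \<le> (\<bar>C\<bar> + 1 + R) * g n"
    proof (cases "n \<ge> N")
      case True
      have "f n \<le> C * g n" using True by (rule N)
      also have "\<dots> \<le> (\<bar>C\<bar> + 1 + R) * g n"
        using pos(2)[OF n] R by (intro mult_right_mono) auto
      finally show ?thesis .
    next
      case False
      have "f n / g n \<le> R" unfolding R_def
        using False n pos by (intro member_le_sum divide_nonneg_nonneg) (auto intro: less_imp_le)
      then have "f n \<le> R * g n" using pos(2)[OF n] by (simp add: pos_divide_le_eq)
      also have "\<dots> \<le> (\<bar>C\<bar> + 1 + R) * g n"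
        using pos(2)[OF n] R by (intro mult_right_mono) auto
      finally show ?thesis .
    qed
  qed
qed

lemma sqrt_divide_mult_self:
  fixes x L :: real
  assumes "L > 0"
  shows "sqrt (x / L) * L = sqrt (x * L)"
proof -
  have "sqrt (x * L) = sqrt (x / L * L\<^sup>2)"
    using assms by (simp add: power2_eq_square)
  also have "\<dots> = sqrt (x / L) * L"
    using assms by (simp only: real_sqrt_mult) simp
  finally show ?thesis ..
qed

text \<open>
  The parameters are \<open>Y = \<lfloor>\<surd>(X L)\<rfloor>\<close>, \<open>h = \<lceil>L\<rceil>\<close> and \<open>z = \<lfloor>X\<^sup>1\<^sup>/\<^sup>1\<^sup>0\<^sup>0\<rfloor>\<close> with \<open>L = ln X\<close>. Then
  \<open>Y\<^sup>2 \<le> h X\<close>, the main term of the sieve is of order \<open>Y h / L\<^sup>2\<close>, hence of order \<open>Y / L\<close>, and its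
  error is of order \<open>L X\<^sup>1\<^sup>2\<^sup>/\<^sup>1\<^sup>0\<^sup>0\<close>, which is negligible. Any fixed exponent below \<open>1 / 24\<close> would serve in
  the choice of \<open>z\<close>.
\<close>

lemma eventually_sqrt_le_card_S_p:
  obtains C where "eventually (\<lambda>X. sqrt (real X / ln (real X)) \<le> C * real (card (S_p X))) sequentially"
proof -
  \<comment> \<open>The number of collisions off the diagonal is at most \<open>K * (Y / L)\<close>; \<open>160000\<close> collects
    the squared exponent \<open>100\<close> and the bounds \<open>Y + 1 \<le> 2 Y\<close> and \<open>h \<le> 2 L\<close>.\<close>
  define K :: real where "K = 2 * (160000 * exp 6 + 1)"
  have K: "K > 0" by (simp add: K_def add_pos_pos)
  have "eventually (\<lambda>X::nat. ln (real X) \<ge> 1) sequentially"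
    and "eventually (\<lambda>X::nat. sqrt (real X * ln (real X)) \<le> real X) sequentially"
    and "eventually (\<lambda>X::nat. sqrt (real X * ln (real X)) \<ge> 4) sequentially"
    and "eventually (\<lambda>X::nat. 4 * ln (real X) * (real X powr (1/100)) ^ 12
           \<le> sqrt (real X * ln (real X)) / 2 / ln (real X)) sequentially"
    by real_asymp+
  then have "eventually (\<lambda>X. sqrt (real X / ln (real X)) \<le> 8 * (1 + 4 * K) * real (card (S_p X))) sequentially"
  proof eventually_elim
    case (elim X)
    define L where "L = ln (real X)"
    define y where "y = sqrt (real X * L)"
    define Y where "Y = nat \<lfloor>y\<rfloor>"
    define h where "h = nat \<lceil>L\<rceil>"
    define \<zeta> where "\<zeta> = real X powr (1/100)"
    define z where "z = nat \<lfloor>\<zeta>\<rfloor>"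
    define \<pi> where "\<pi> = real (card (primes_le Y))"
    define S where "S = real (card (S_p X))"
    have L: "L \<ge> 1" and y: "y \<le> real X" "y \<ge> 4" and \<zeta>12: "4 * L * \<zeta> ^ 12 \<le> y / 2 / L"
      using elim by (simp_all add: L_def y_def \<zeta>_def)
    have X: "real X \<ge> 1" using y by simp
    have Y: "y / 2 \<le> real Y" "real Y \<le> y" "Y \<ge> 2" "Y \<le> X"
      using y unfolding Y_def by linarith+
    have h: "L \<le> real h" "real h \<le> 2 * L"
      using L unfolding h_def by linarith+
    have \<zeta>: "\<zeta> \<ge> 1" "ln \<zeta> = L / 100"
      using X by (auto simp: \<zeta>_def L_def ge_one_powr_ge_zero ln_powr)
    have z: "z \<ge> 1" "real z \<le> \<zeta>" "\<zeta> \<le> real z + 1"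
      using \<zeta>(1) unfolding z_def by linarith+
    have ln_z: "L / 100 \<le> ln (real z + 1)"
      using z \<zeta> by (metis ln_mono order_less_le_trans zero_less_one)
    have "Y\<^sup>2 \<le> h * X"
    proof -
      have "real Y ^ 2 \<le> y ^ 2" using Y by (intro power_mono) auto
      also have "\<dots> = L * real X" using L X by (simp add: y_def)
      also have "\<dots> \<le> real h * real X" using h by (intro mult_right_mono) auto
      finally have "real (Y\<^sup>2) \<le> real (h * X)" by simp
      then show ?thesis by linarith
    qed
    note main = card_S_p_lower[OF Y(4) this z(1), folded \<pi>_def S_def]
    have E1: "4 * exp 6 * (real Y + 1) * real h / (ln (real z + 1))\<^sup>2 \<le> 160000 * exp 6 * (real Y / L)"
    proof -
      have "4 * exp 6 * (real Y + 1) * real h / (ln (real z + 1))\<^sup>2 \<le> 4 * exp 6 * (2 * real Y) * (2 * L) / (L / 100)\<^sup>2"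
        using Y h L ln_z by (intro frac_le mult_mono power_mono) auto
      also have "\<dots> = 160000 * exp 6 * (real Y / L)"
        using L by (simp add: power2_eq_square)
      finally show ?thesis .
    qed
    have E2: "real h * (real z ^ 2 + real z ^ 12) \<le> real Y / L"
    proof -
      have "real z ^ 2 \<le> real z ^ 12" using z by (intro power_increasing) auto
      moreover have "real z ^ 12 \<le> \<zeta> ^ 12" using z by (intro power_mono) auto
      ultimately have "real h * (real z ^ 2 + real z ^ 12) \<le> 2 * L * (2 * \<zeta> ^ 12)"
        using h L by (intro mult_mono) auto
      also have "\<dots> \<le> y / 2 / L" using \<zeta>12 by simp
      also have "\<dots> \<le> real Y / L" using Y L by (intro divide_right_mono) auto
      finally show ?thesis .
    qed
    have "ln (real Y) \<le> L" unfolding L_def using Y by (intro ln_mono) auto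
    then have "real Y / 4 \<le> \<pi> * L"
      using card_primes_le_lower[OF Y(3)] unfolding \<pi>_def
      by (meson mult_left_mono of_nat_0_le_iff order_trans)
    then have \<pi>: "real Y / L \<le> 4 * \<pi>"
      using L by (simp add: pos_divide_le_eq)
    moreover have "real Y / L > 0" using Y L by (intro divide_pos_pos) auto
    ultimately have \<pi>_pos: "\<pi> > 0" by simp
    have "\<pi> ^ 2 \<le> S * (\<pi> + K * (real Y / L))"
    proof (rule order_trans[OF main], rule mult_left_mono)
      show "\<pi> + 2 * (4 * exp 6 * (real Y + 1) * real h / (ln (real z + 1))\<^sup>2 + real h * (real z ^ 2 + real z ^ 12))
        \<le> \<pi> + K * (real Y / L)"
      proof -
        have "2 * (A + B) \<le> 2 * (160000 * exp 6 + 1) * q" if "A \<le> 160000 * exp 6 * q" "B \<le> q" for A B q :: real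
          using that by (simp add: algebra_simps)
        from this[OF E1 E2] show ?thesis unfolding K_def by (rule add_left_mono)
      qed
    qed (simp add: S_def)
    also have "\<dots> \<le> S * (\<pi> + K * (4 * \<pi>))"
      using \<pi> K by (intro mult_left_mono add_left_mono) (auto simp: S_def)
    finally have "\<pi> * \<pi> \<le> \<pi> * ((1 + 4 * K) * S)"
      by (simp add: power2_eq_square algebra_simps)
    then have \<pi>_le: "\<pi> \<le> (1 + 4 * K) * S"
      using \<pi>_pos by simp
    have "sqrt (real X / L) = y / L"
      using L sqrt_divide_mult_self[of L "real X"] by (simp add: y_def field_simps)
    also have "\<dots> = 2 * (y / 2 / L)" by simp
    also have "\<dots> \<le> 2 * (real Y / L)" using Y L by (intro mult_left_mono divide_right_mono) auto
    also have "\<dots> \<le> 8 * \<pi>" using \<pi> by simp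
    also have "\<dots> \<le> 8 * ((1 + 4 * K) * S)" using \<pi>_le by (rule mult_left_mono) simp
    finally show ?case by (simp only: L_def S_def mult.assoc)
  qed
  then show ?thesis by (rule that)
qed

lemma eventually_card_S_p_le_sqrt:
  "eventually (\<lambda>X. real (card (S_p X)) \<le> 27 * sqrt (real X / ln (real X))) sequentially"
proof -
  have "eventually (\<lambda>X::nat. ln (real X) \<ge> 1) sequentially"
    and "eventually (\<lambda>X::nat. sqrt (real X * ln (real X)) \<ge> 4) sequentially"
    and "eventually (\<lambda>X::nat. ln (real X) / 4 \<le> ln (sqrt (real X * ln (real X)) / 2)) sequentially"
    and "eventually (\<lambda>X::nat. sqrt (real X / ln (real X)) \<ge> 1) sequentially"
    by real_asymp+
  then show ?thesis
  proof eventually_elim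
    case (elim X)
    define L where "L = ln (real X)"
    define y where "y = sqrt (real X * L)"
    define Y where "Y = nat \<lfloor>y\<rfloor>"
    define s where "s = sqrt (real X / L)"
    have L: "L \<ge> 1" and y: "y \<ge> 4" "L / 4 \<le> ln (y / 2)" and s: "s \<ge> 1"
      using elim by (simp_all only: L_def y_def s_def)
    have X: "real X > 0" using y by (auto simp: y_def intro: ccontr)
    have Y: "y / 2 \<le> real Y" "real Y \<le> y" "Y \<ge> 1"
      using y unfolding Y_def by linarith+
    have "y = s * L"
      using L sqrt_divide_mult_self[of L "real X"] by (simp add: y_def s_def)
    have "s * s = real X / L"
      using L X unfolding s_def by (simp only: real_sqrt_mult_self) simp
    then have "real X = s * y"
      using L unfolding \<open>y = s * L\<close> by (simp add: field_simps)
    have "L / 4 \<le> ln (real Y)"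
      using y Y by (intro order_trans[OF y(2)] ln_mono) auto
    then have "real (card (primes_le Y)) * (L / 4) \<le> real (card (primes_le Y)) * ln (real Y)"
      by (intro mult_left_mono) auto
    also have "\<dots> \<le> 6 * y"
      using card_primes_le_upper[OF Y(3)] Y(2) by linarith
    also have "\<dots> = (24 * s) * (L / 4)" using \<open>y = s * L\<close> by simp
    finally have 1: "real (card (primes_le Y)) \<le> 24 * s" using L by simp
    have "real X / real Y \<le> real X / (y / 2)"
      using Y y X by (intro divide_left_mono) auto
    also have "\<dots> = 2 * s" using \<open>real X = s * y\<close> y by simp
    finally have "real (card (S_p X)) \<le> 27 * s"
      using card_S_p_upper[OF Y(3), of X] 1 s by linarith
    then show ?case by (simp only: s_def L_def)
  qed
qed

theorem theorem2:
  shows "\<exists>c1 c2 :: real. c1 > 0 \<and> c2 > 0 \<and>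
    (\<forall>X :: nat. X \<ge> 2 \<longrightarrow>
       c1 * (real X / ln (real X)) powr (1/2) \<le> real (card (S_p X)) \<and>
       real (card (S_p X)) \<le> c2 * (real X / ln (real X)) powr (1/2))"
proof -
  define s where "s = (\<lambda>X::nat. sqrt (real X / ln (real X)))"
  have s_pos: "s X > 0" if "X \<ge> 2" for X using that by (simp add: s_def)
  have card_pos: "real (card (S_p X)) > 0" if "X \<ge> 2" for X
  proof -
    have "2 \<in> primes_le X" using that by (simp add: primes_le_def)
    then have "S_p X \<noteq> {}" unfolding S_p_eq_image by blast
    then show ?thesis using finite_S_p by (simp add: card_gt_0_iff)
  qed
  obtain C where "eventually (\<lambda>X. s X \<le> C * real (card (S_p X))) sequentially"
    unfolding s_def by (rule eventually_sqrt_le_card_S_p)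
  from eventually_le_imp_uniformly_le[of 2 s "\<lambda>X. real (card (S_p X))", OF s_pos card_pos this]
  obtain a where a: "a > 0" "\<And>X. X \<ge> 2 \<Longrightarrow> s X \<le> a * real (card (S_p X))" by blast
  have "eventually (\<lambda>X. real (card (S_p X)) \<le> 27 * s X) sequentially"
    unfolding s_def by (rule eventually_card_S_p_le_sqrt)
  from eventually_le_imp_uniformly_le[of 2 "\<lambda>X. real (card (S_p X))" s, OF card_pos s_pos this]
  obtain b where b: "b > 0" "\<And>X. X \<ge> 2 \<Longrightarrow> real (card (S_p X)) \<le> b * s X" by blast
  have powr: "(real X / ln (real X)) powr (1/2) = s X" if "X \<ge> 2" for X
    using that by (simp add: s_def powr_half_sqrt)
  show ?thesis
  proof (intro exI conjI allI impI)
    show "1 / a > 0" "b > 0" using a(1) b(1) by auto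
    fix X :: nat assume X: "X \<ge> 2"
    show "1 / a * (real X / ln (real X)) powr (1/2) \<le> real (card (S_p X))"
      using a(2)[OF X] a(1) unfolding powr[OF X] by (simp add: pos_divide_le_eq mult.commute)
    show "real (card (S_p X)) \<le> b * (real X / ln (real X)) powr (1/2)"
      using b(2)[OF X] unfolding powr[OF X] .
  qed
qed

end
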